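(* Let $G,F\in\mathcal M_3(\mathbb R)$ have nonnegative off-diagonal entries, let $m\in\mathbb R^3$ have positive entries with $m^TF=0$, and let $0<a<A$. With the notation of the context, assume: (1) $G$ and $F$ are both reducible, and $G+\alpha F$ is irreducible for every $\alpha>0$. (2) The Perron eigenvalue $\alpha\mapsto\lambda_P(\alpha)$ is bounded on $(0,+\infty)$ and admits a global maximum on $(0,+\infty)$, attained at some $\alpha^*$ with $a<\alpha^*<A$. (3) Each of the vectors $e_0=\lim_{\alpha\to0}e_\alpha$ and $e_\infty=\lim_{\alpha\to+\infty}e_\alpha$ has at least one zero coordinate. (4) The quantity $\left\langle \frac{de_\alpha}{d\alpha},\Theta Fe_\alpha\right\rangle$ has a constant strict sign for $\alpha\ge 0$ (it is positive for all $\alpha\geq 0$ or negative for all $\alpha\ge0$). (5) There exists $\delta_0>0$ such that: for any constant $\beta\in(A-\delta_0,A+\delta_0)$, the trajectory of $\dot y=b(y,\beta)$ starting from $e_0$ (which connects $e_0$ to $e_\beta$) does not cross $\Phi_0$ for $t>0$; and for any constant $\beta\in(a-\delta_0,a+\delta_0)$, the trajectory of $\dot y=b(y,\beta)$ starting from $e_\infty$ (which connects $e_\infty$ to $e_\beta$) does not cross $\Phi_0$ for $t>0$. For $T>0$ and $y\in\mathcal S$ let $$u(T,y)=\sup_\alpha\left\{\int_0^{T}L(y_\alpha(s))\,ds\;:\;\dot y_\alpha(s)=b(y_\alpha(s),\alpha(s)),\ y_\alpha(0)=y\right\},$$ where the supremum is over all measurable $\alpha:(0,T)\to[a,A]$.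 Then $$\lim_{T\to+\infty}\frac{u(T,y)}{T}=\lambda_{HJ}\quad\text{uniformly for }y\in\mathcal S,$$ where $\lambda_{HJ}$ is the constant defined in the context.
   Context: Notation. $\mathcal S=\{y\in\mathbb R^3: y\ge0,\ \langle m,y\rangle=1\}$, with tangent space $T\mathcal S=\{v\in\mathbb R^3:\langle m,v\rangle=0\}$ equipped with the Euclidean inner product of $\mathbb R^3$; $\Theta$ is the direct rotation by angle $\pi/2$ on the plane $T\mathcal S$ (for a fixed orientation). $L(y)=\langle m,Gy\rangle$. The vector field on $\mathcal S$ with control parameter $\alpha$ is $b(y,\alpha)=(G+\alpha F)y-\langle m,Gy\rangle y$ (it is tangent to $\mathcal S$). For $\alpha>0$, since $G+\alpha F$ is irreducible with nonnegative off-diagonal entries, Perron–Frobenius gives a simple dominant real eigenvalue $\lambda_P(\alpha)$ and a unique positive eigenvector $e_\alpha$ with $(G+\alpha F)e_\alpha=\lambda_P(\alpha)e_\alpha$ and $\langle m,e_\alpha\rangle=1$. $e_0$ and $e_\infty$ denote the limits of $e_\alpha$ as $\alpha\to0$ and $\alpha\to+\infty$. $\Phi_0=\{e_\alpha:\alpha\in[0,+\infty)\}\subset\mathcal S$ is the set of Perron eigenvectors. At $\alpha=0$, $\frac{de_\alpha}{d\alpha}$ is the right derivative. Definition of $\lambda_{HJ}$: for $\epsilon>0$ let $u_\epsilon(y)=\sup_\alpha\int_0^{+\infty}e^{-\epsilon t}L(y_\alpha(t))\,dt$, the supremum being over measurable $\alpha:(0,+\infty)\to[a,A]$ with $\dot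 y_\alpha=b(y_\alpha,\alpha)$, $y_\alpha(0)=y$. Under hypotheses (1)–(5), $\epsilon u_\epsilon$ converges as $\epsilon\to0$, uniformly on $\mathcal S$, to a constant; this constant is $\lambda_{HJ}$. *)

theory Defs
  imports "HOL-Analysis.Analysis" "HOL-Computational_Algebra.Polynomial"
begin

definition nonneg_off_diagonal :: "real^'n^'n \<Rightarrow> bool" where
  "nonneg_off_diagonal M \<longleftrightarrow> (\<forall>i j. i \<noteq> j \<longrightarrow> 0 \<le> M $ i $ j)"

(* Block triangular after a simultaneous permutation of rows and columns:
   I and its complement are the two index blocks. *)
definition reducible_matrix :: "real^'n^'n \<Rightarrow> bool" where
  "reducible_matrix M \<longleftrightarrow>
     (\<exists>I. I \<noteq> {} \<and> I \<noteq> UNIV \<and> (\<forall>i\<in>I. \<forall>j\<in>-I. M $ i $ j = 0))"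

abbreviation irreducible_matrix :: "real^'n^'n \<Rightarrow> bool" where
  "irreducible_matrix M \<equiv> \<not> reducible_matrix M"

definition charpoly :: "real^'n^'n \<Rightarrow> real poly" where
  "charpoly M = det (mat [:0, 1:] - (\<chi> i j. [:M $ i $ j:]))"

(* "Dominant" refers to real parts, since the matrices are only assumed to be
   nonnegative off the diagonal: every other complex eigenvalue has a strictly
   smaller real part.  The description is meant for irreducible such matrices,
   where Perron-Frobenius provides existence; at most one l can satisfy it. *)
definition perron_eigenvalue :: "real^'n^'n \<Rightarrow> real" where
  "perron_eigenvalue M = (THE l. order l (charpoly M) = 1 \<and>
     (\<forall>z::complex. poly (map_poly complex_of_real (charpoly M)) z = 0 \<and> z \<noteq> complex_of_real l
        \<longrightarrow> Re z < l))"

definition perron_vector :: "real^'n^'n \<Rightarrow> real^'n \<Rightarrow> real^'n" where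
  "perron_vector M m = (THE e. (\<forall>i. 0 < e $ i) \<and> M *v e = perron_eigenvalue M *\<^sub>R e \<and> m \<bullet> e = 1)"

definition perron_lambda :: "real^3^3 \<Rightarrow> real^3^3 \<Rightarrow> real \<Rightarrow> real" where
  "perron_lambda G F \<alpha> = perron_eigenvalue (G + \<alpha> *\<^sub>R F)"

definition perron_e :: "real^3^3 \<Rightarrow> real^3^3 \<Rightarrow> real^3 \<Rightarrow> real \<Rightarrow> real^3" where
  "perron_e G F m \<alpha> =
     (if \<alpha> = 0 then Lim (at_right 0) (\<lambda>\<beta>. perron_vector (G + \<beta> *\<^sub>R F) m)
      else perron_vector (G + \<alpha> *\<^sub>R F) m)"

definition perron_e_infinity :: "real^3^3 \<Rightarrow> real^3^3 \<Rightarrow> real^3 \<Rightarrow> real^3" where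
  "perron_e_infinity G F m = Lim at_top (perron_e G F m)"

definition perron_set :: "real^3^3 \<Rightarrow> real^3^3 \<Rightarrow> real^3 \<Rightarrow> (real^3) set" where
  "perron_set G F m = perron_e G F m ` {0..}"

definition simplex_m :: "real^3 \<Rightarrow> (real^3) set" where
  "simplex_m m = {y. (\<forall>i. 0 \<le> y $ i) \<and> m \<bullet> y = 1}"

(* Rotation by a right angle in the plane orthogonal to m, oriented by the
   normal m; the opposite orientation replaces the map by its negative. *)
definition rot_m :: "real^3 \<Rightarrow> real^3 \<Rightarrow> real^3" where
  "rot_m m v = cross3 ((1 / norm m) *\<^sub>R m) v"

definition payoff :: "real^3^3 \<Rightarrow> real^3 \<Rightarrow> real^3 \<Rightarrow> real" where
  "payoff G m y = m \<bullet> (G *v y)"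

definition field_b :: "real^3^3 \<Rightarrow> real^3^3 \<Rightarrow> real^3 \<Rightarrow> real^3 \<Rightarrow> real \<Rightarrow> real^3" where
  "field_b G F m y \<alpha> = (G + \<alpha> *\<^sub>R F) *v y - (m \<bullet> (G *v y)) *\<^sub>R y"

definition controls :: "real \<Rightarrow> real \<Rightarrow> real set \<Rightarrow> (real \<Rightarrow> real) set" where
  "controls a A J = {\<alpha>. \<alpha> \<in> borel_measurable (lebesgue_on J) \<and> (\<forall>t\<in>J. \<alpha> t \<in> {a..A})}"

(* Caratheodory solutions, in integral form, of y' = b(y, \<alpha>) with y(0) = y0;
   J is {0..T} or {0..}.  As b is a vector field on the simplex, solutions take
   their values there. *)
definition trajectory ::
  "real^3^3 \<Rightarrow> real^3^3 \<Rightarrow> real^3 \<Rightarrow> real set \<Rightarrow> (real \<Rightarrow> real) \<Rightarrow> real^3 \<Rightarrow> (real \<Rightarrow> real^3) \<Rightarrow> bool" where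
  "trajectory G F m J \<alpha> y0 y \<longleftrightarrow>
     (\<forall>t\<in>J. y t \<in> simplex_m m \<and>
        (\<lambda>s. field_b G F m (y s) (\<alpha> s)) absolutely_integrable_on {0..t} \<and>
        y t = y0 + integral {0..t} (\<lambda>s. field_b G F m (y s) (\<alpha> s)))"

definition discounted_value ::
  "real^3^3 \<Rightarrow> real^3^3 \<Rightarrow> real^3 \<Rightarrow> real \<Rightarrow> real \<Rightarrow> real \<Rightarrow> real^3 \<Rightarrow> real" where
  "discounted_value G F m a A \<epsilon> y0 =
     Sup {integral {0..} (\<lambda>t. exp (- \<epsilon> * t) * payoff G m (y t)) | \<alpha> y.
            \<alpha> \<in> controls a A {0<..} \<and> trajectory G F m {0..} \<alpha> y0 y}"

definition lambda_HJ :: "real^3^3 \<Rightarrow> real^3^3 \<Rightarrow> real^3 \<Rightarrow> real \<Rightarrow> real \<Rightarrow> real" where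
  "lambda_HJ G F m a A =
     (THE l. uniform_limit (simplex_m m) (\<lambda>\<epsilon> y. \<epsilon> * discounted_value G F m a A \<epsilon> y) (\<lambda>_. l) (at_right 0))"

definition finite_horizon_value ::
  "real^3^3 \<Rightarrow> real^3^3 \<Rightarrow> real^3 \<Rightarrow> real \<Rightarrow> real \<Rightarrow> real \<Rightarrow> real^3 \<Rightarrow> real" where
  "finite_horizon_value G F m a A T y0 =
     Sup {integral {0..T} (\<lambda>s. payoff G m (y s)) | \<alpha> y.
            \<alpha> \<in> controls a A {0<..<T} \<and> trajectory G F m {0..T} \<alpha> y0 y}"

lemma lambda_HJ_eqI:
  assumes m: "\<forall>i. 0 < m $ i"
    and lim: "uniform_limit (simplex_m m) (\<lambda>\<epsilon> y. \<epsilon> * discounted_value G F m a A \<epsilon> y) (\<lambda>_. l) (at_right 0)"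
  shows "lambda_HJ G F m a A = l"
proof -
  let ?y = "axis 1 (1 / m $ 1) :: real^3"
  have y: "?y \<in> simplex_m m"
    using m by (auto simp: simplex_m_def axis_def inner_vec_def sum_3 less_imp_le less_imp_neq[THEN not_sym])
  show ?thesis
    unfolding lambda_HJ_def
  proof (rule the_equality)
    show "uniform_limit (simplex_m m)
      (\<lambda>\<epsilon> y. \<epsilon> * discounted_value G F m a A \<epsilon> y) (\<lambda>_. l) (at_right 0)"
      by (fact lim)
  next
    fix l' assume l': "uniform_limit (simplex_m m)
      (\<lambda>\<epsilon> y. \<epsilon> * discounted_value G F m a A \<epsilon> y) (\<lambda>_. l') (at_right 0)"
    show "l' = l"
      using tendsto_unique[OF _ tendsto_uniform_limitI[OF l' y] tendsto_uniform_limitI[OF lim y]]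
      by simp
  qed
qed

lemma rot_m_rotation:
  assumes m: "m \<noteq> 0" and v: "m \<bullet> v = 0"
  shows "m \<bullet> rot_m m v = 0" "v \<bullet> rot_m m v = 0" "norm (rot_m m v) = norm v"
    and "rot_m m (rot_m m v) = - v"
proof -
  let ?n = "(1 / norm m) *\<^sub>R m"
  have nn: "?n \<bullet> ?n = 1" using m by (simp add: dot_square_norm power2_eq_square)
  have nv: "?n \<bullet> v = 0" using v by simp
  show "m \<bullet> rot_m m v = 0" "v \<bullet> rot_m m v = 0"
    by (simp_all add: rot_m_def dot_cross_self cross_mult_left)
  have "(norm (rot_m m v))\<^sup>2 = (norm v)\<^sup>2"
    using norm_cross_dot[of ?n v] nv nn
    by (simp add: rot_m_def power_mult_distrib power2_norm_eq_inner)
  then show "norm (rot_m m v) = norm v"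
    by simp
  show "rot_m m (rot_m m v) = - v"
    unfolding rot_m_def by (simp only: Lagrange nn nv) simp
qed

end

theory Submission
  imports Defs
begin

text \<open>The normalised dynamics on the simplex is the projection of the linear system
  \<open>W' = (G + \<alpha>F) W\<close>, and since \<open>m\<^sup>T F = 0\<close> the payoff is the logarithmic growth rate of
  \<open>\<langle>m, W\<rangle>\<close>. The linear flow preserves the positive cone and, as \<open>G + aF\<close> is irreducible and
  \<open>F\<close> has nonnegative off-diagonal entries, it maps the closed cone into its interior within
  time 2, uniformly in the control. Hence two trajectories driven by the same control have
  integrated payoffs that differ by at most a constant \<open>C\<close>, for all times and all initial
  points.

  Dynamic programming on \<open>[0, T]\<close> then gives
  \<open>(1 - e\<^sup>-\<^sup>\<epsilon>\<^sup>T) u\<^sub>\<epsilon>(y) = u(T, y) + O(1 + \<epsilon> T\<^sup>2)\<close>, so that \<open>u(T, y) / T\<close> and \<open>\<epsilon> u\<^sub>\<epsilon>(y')\<close> differ by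
  \<open>O(1 / T + \<epsilon> T + \<epsilon>)\<close> for all \<open>\<epsilon>, T\<close>. Letting \<open>\<epsilon> \<rightarrow> 0\<close> shows that \<open>u(T, y) / T\<close> is Cauchy as
  \<open>T \<rightarrow> \<infinity>\<close>, and \<open>T = \<epsilon>\<^sup>-\<^sup>1\<^sup>/\<^sup>2\<close> shows that \<open>\<epsilon> u\<^sub>\<epsilon>\<close> has the same limit.\<close>

section \<open>Caratheodory solutions of control-affine equations\<close>

text \<open>A control is merely measurable, but it is bounded, so its product with a continuous
  function is absolutely integrable. Controls live on all of \<open>UNIV\<close> here, so that
  shifting and gluing never leave their domain.\<close>

lemma affine_control_integrable:
  fixes f g :: "real \<Rightarrow> 'a::euclidean_space"
  assumes \<alpha>: "\<alpha> \<in> controls a A UNIV" and f: "continuous_on {s..t} f" and g: "continuous_on {s..t} g"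
  shows "(\<lambda>r. f r + \<alpha> r *\<^sub>R g r) absolutely_integrable_on {s..t}"
proof (rule set_integral_add)
  show "set_integrable lebesgue {s..t} f"
    using absolutely_integrable_continuous[of s t f] f by simp
  have "\<alpha> \<in> borel_measurable lebesgue" and "range \<alpha> \<subseteq> {a..A}"
    using \<alpha> by (auto simp: controls_def)
  then have m: "\<alpha> \<in> borel_measurable (lebesgue_on {s..t})" "bounded (\<alpha> ` {s..t})"
    by (auto intro: measurable_restrict_space1 bounded_subset[OF bounded_closed_interval[of a A]])
  show "set_integrable lebesgue {s..t} (\<lambda>r. \<alpha> r *\<^sub>R g r)"
  proof (rule absolutely_integrable_bounded_measurable_product[where h="(*\<^sub>R)", OF _ m(1) _ m(2)])
    show "bilinear ((*\<^sub>R) :: real \<Rightarrow> 'a \<Rightarrow> 'a)"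
      by (simp add: bilinear_conv_bounded_bilinear bounded_bilinear_scaleR)
    show "set_integrable lebesgue {s..t} g"
      using absolutely_integrable_continuous[of s t g] g by simp
  qed simp
qed

lemma control_abs_le:
  assumes "\<alpha> \<in> controls a A UNIV" shows "\<bar>\<alpha> t\<bar> \<le> \<bar>a\<bar> + \<bar>A\<bar>"
proof -
  have "a \<le> \<alpha> t" "\<alpha> t \<le> A" using assms by (auto simp: controls_def)
  then show ?thesis by linarith
qed

lemma controls_shift:
  assumes "\<alpha> \<in> controls a A UNIV" shows "(\<lambda>t. \<alpha> (s + t)) \<in> controls a A UNIV"
proof -
  have "(\<lambda>t. \<alpha> (s + 1 *\<^sub>R t)) \<in> borel_measurable lebesgue"
    using assms lebesgue_affine_measurable[where c="\<lambda>_::real. 1" and t=s]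
    by (auto simp: controls_def lebesgue_on_UNIV_eq intro: measurable_compose[of _ lebesgue lebesgue \<alpha>])
  then show ?thesis using assms by (auto simp: controls_def lebesgue_on_UNIV_eq)
qed

lemma controls_concat:
  assumes "\<alpha> \<in> controls a A UNIV" "\<beta> \<in> controls a A UNIV"
  shows "(\<lambda>t. if t < T then \<alpha> t else \<beta> t) \<in> controls a A UNIV"
  using assms by (auto simp: controls_def lebesgue_on_UNIV_eq intro!: measurable_If)

text \<open>Increments over every subinterval are recorded, not only those starting at 0, so
  restriction and time shift are immediate. Arbitrary \<open>c\<close> and \<open>d\<close> let one
  notion serve both the quadratic equation on the simplex and its linear lift.\<close>

definition caratheodory ::
  "real set \<Rightarrow> ('a \<Rightarrow> 'a) \<Rightarrow> ('a \<Rightarrow> 'a) \<Rightarrow> (real \<Rightarrow> real) \<Rightarrow> (real \<Rightarrow> 'a::euclidean_space) \<Rightarrow> bool" where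
  "caratheodory J c d \<alpha> x \<longleftrightarrow> (\<forall>s\<in>J. \<forall>t\<in>J. s \<le> t \<longrightarrow>
     ((\<lambda>r. c (x r) + \<alpha> r *\<^sub>R d (x r)) has_integral (x t - x s)) {s..t})"

lemma caratheodoryD:
  "caratheodory J c d \<alpha> x \<Longrightarrow> s \<in> J \<Longrightarrow> t \<in> J \<Longrightarrow> s \<le> t \<Longrightarrow>
    ((\<lambda>r. c (x r) + \<alpha> r *\<^sub>R d (x r)) has_integral (x t - x s)) {s..t}"
  by (auto simp: caratheodory_def)

lemma caratheodory_subset: "caratheodory J c d \<alpha> x \<Longrightarrow> I \<subseteq> J \<Longrightarrow> caratheodory I c d \<alpha> x"
  by (auto simp: caratheodory_def)

lemma caratheodoryI0:
  assumes "\<And>t. t \<in> J \<Longrightarrow> ((\<lambda>r. c (x r) + \<alpha> r *\<^sub>R d (x r)) has_integral (x t - x 0)) {0..t}"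
    and J: "J \<subseteq> {0..}"
  shows "caratheodory J c d \<alpha> x"
  unfolding caratheodory_def
proof (intro ballI impI)
  fix s t assume st: "s \<in> J" "t \<in> J" "s \<le> t"
  let ?f = "\<lambda>r. c (x r) + \<alpha> r *\<^sub>R d (x r)"
  have "{s..t} \<subseteq> {0..t}" using st J by auto
  with has_integral_integrable[OF assms(1)[OF st(2)]] have "?f integrable_on {s..t}"
    by (rule integrable_subinterval_real)
  then obtain i where i: "(?f has_integral i) {s..t}" by blast
  have "(?f has_integral (x s - x 0) + i) {0..t}"
    using st J by (intro has_integral_combine[OF _ _ assms(1) i]) auto
  then have "(x s - x 0) + i = x t - x 0"
    using assms(1)[OF st(2)] has_integral_unique by blast
  then have "i = x t - x s" by (simp add: algebra_simps)
  then show "(?f has_integral (x t - x s)) {s..t}" using i by simp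
qed

lemma caratheodory_continuous_on:
  assumes "caratheodory J c d \<alpha> x" "{s..t} \<subseteq> J"
  shows "continuous_on {s..t} x"
proof (cases "s \<le> t")
  case True
  let ?f = "\<lambda>r. c (x r) + \<alpha> r *\<^sub>R d (x r)"
  have "x r = x s + integral {s..r} ?f" if "r \<in> {s..t}" for r
  proof -
    have "s \<in> J" "r \<in> J" using that assms(2) by auto
    from integral_unique[OF caratheodoryD[OF assms(1) this]] that show ?thesis by simp
  qed
  moreover have "continuous_on {s..t} (\<lambda>r. x s + integral {s..r} ?f)"
  proof (intro continuous_intros indefinite_integral_continuous_1)
    have "s \<in> J" "t \<in> J" using assms(2) True by auto
    from has_integral_integrable[OF caratheodoryD[OF assms(1) this True]] show "?f integrable_on {s..t}" .
  qed
  ultimately show ?thesis by (metis (no_types, lifting) continuous_on_cong)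
qed auto

lemma continuous_on_atLeast_iff:
  fixes x :: "real \<Rightarrow> 'a::topological_space"
  shows "continuous_on {0..} x \<longleftrightarrow> (\<forall>t\<ge>0. continuous_on {0..t} x)"
proof
  assume *: "\<forall>t\<ge>0. continuous_on {0..t} x"
  show "continuous_on {0..} x"
    unfolding continuous_on_eq_continuous_within
  proof
    fix t :: real assume t: "t \<in> {0..}"
    \<comment> \<open>The right end \<open>t+1\<close> leaves room beyond t, so the bounded interval
      contains a full neighbourhood of t in \<open>{0..}\<close>.\<close>
    then have "continuous (at t within {0..t+1}) x"
      using * by (auto simp: continuous_on_eq_continuous_within)
    moreover have "at t within {0..t+1} = at t within {0..}"
      by (rule at_within_nhd[where S="{..<t+1}"]) auto
    ultimately show "continuous (at t within {0..}) x"
      by (simp add: continuous_within)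
  qed
qed (auto intro: continuous_on_subset)

lemma caratheodory_continuous_on_atLeast:
  "caratheodory {0..} c d \<alpha> x \<Longrightarrow> continuous_on {0..} x"
  by (auto simp: continuous_on_atLeast_iff intro!: caratheodory_continuous_on[of "{0..}" c d \<alpha>])

lemma caratheodory_shift:
  assumes "caratheodory {0..} c d \<alpha> x" "0 \<le> T"
  shows "caratheodory {0..} c d (\<lambda>t. \<alpha> (T + t)) (\<lambda>t. x (T + t))"
  unfolding caratheodory_def
proof (intro ballI impI)
  fix s t :: real assume "s \<in> {0..}" "t \<in> {0..}" "s \<le> t"
  then show "((\<lambda>r. c (x (T + r)) + \<alpha> (T + r) *\<^sub>R d (x (T + r))) has_integral x (T + t) - x (T + s)) {s..t}"
    using has_integral_shift_real_ivl[OF caratheodoryD[OF assms(1), of "T+s" "T+t"], of T] assms(2)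
    by (simp add: add.commute)
qed

lemma caratheodory_concat:
  assumes x: "caratheodory {0..T} c d \<alpha> x" and z: "caratheodory {0..} c d \<beta> z" and T: "0 \<le> T"
    and eq: "z 0 = x T"
  shows "caratheodory {0..} c d (\<lambda>t. if t < T then \<alpha> t else \<beta> (t - T)) (\<lambda>t. if t < T then x t else z (t - T))"
    (is "caratheodory _ c d ?\<alpha> ?x")
proof (rule caratheodoryI0)
  let ?f = "\<lambda>r. c (?x r) + ?\<alpha> r *\<^sub>R d (?x r)"
  fix t :: real assume t: "t \<in> {0..}"
  have 1: "(?f has_integral (?x t - ?x 0)) {0..t}" if t': "0 \<le> t" "t \<le> T" for t
  proof -
    have "?x 0 = x 0" "?x t = x t" using t' eq T by (cases "t = T"; cases "T = 0"; auto)+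
    \<comment> \<open>At the junction the glued control takes the value \<open>\<beta> 0\<close>,
      which may differ from \<open>\<alpha> T\<close>; a single point does not affect the
      integral.\<close>
    moreover have "(?f has_integral x t - x 0) {0..t}"
      by (rule has_integral_spike_finite[OF _ _ caratheodoryD[OF x], of "{T}"]) (use t' in auto)
    ultimately show ?thesis by simp
  qed
  show "(?f has_integral (?x t - ?x 0)) {0..t}"
  proof (cases "t \<le> T")
    case True then show ?thesis using 1[of t] t by simp
  next
    case False
    have "((\<lambda>r. c (z (r - T)) + \<beta> (r - T) *\<^sub>R d (z (r - T))) has_integral z (t - T) - z 0) {T..t}"
      using has_integral_shift_real_ivl[OF caratheodoryD[OF z, of 0 "t - T"], of "-T"] False by simp
    then have "(?f has_integral z (t - T) - z 0) {T..t}"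
      by (rule has_integral_eq[rotated]) auto
    then have "(?f has_integral (?x T - ?x 0) + (z (t - T) - z 0)) {0..t}"
      using False T by (intro has_integral_combine[OF _ _ 1]) auto
    then show ?thesis using False eq T by auto
  qed
qed auto

text \<open>A product rule for an indefinite integral \<open>x\<close> of a bounded
  \<open>g\<close>, which need not be differentiable at every point. The defect \<open>H\<close>
  between the two sides has increments of order (t - s)^2, so its derivative vanishes everywhere and
  it is constant.\<close>

lemma has_integral_scaleR_product:
  fixes x g :: "real \<Rightarrow> 'a::euclidean_space"
  assumes p: "\<And>t. t \<in> {a..b} \<Longrightarrow> (p has_real_derivative p' t) (at t within {a..b})"
    and p': "continuous_on {a..b} p'"
    and x: "\<And>s t. a \<le> s \<Longrightarrow> s \<le> t \<Longrightarrow> t \<le> b \<Longrightarrow> (g has_integral x t - x s) {s..t}"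
    and g: "g absolutely_integrable_on {a..b}" "\<And>t. t \<in> {a..b} \<Longrightarrow> norm (g t) \<le> B"
    and ab: "a \<le> b"
  shows "((\<lambda>r. p' r *\<^sub>R x r + p r *\<^sub>R g r) has_integral p b *\<^sub>R x b - p a *\<^sub>R x a) {a..b}"
proof -
  have B0: "0 \<le> B" using g(2)[of a] ab norm_ge_zero order_trans by (metis atLeastAtMost_iff order_refl)
  have pc: "continuous_on {a..b} p"
    by (rule DERIV_continuous_on[OF p])
  have xlip: "norm (x t - x s) \<le> B * (t - s)" if "a \<le> s" "s \<le> t" "t \<le> b" for s t
    using has_integral_bound_real[OF B0 finite.emptyI x[OF that]] g(2) that by simp
  have xc: "continuous_on {a..b} x"
  proof -
    have "B-lipschitz_on {a..b} x"
    proof (rule lipschitz_onI)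
      fix s t assume "s \<in> {a..b}" "t \<in> {a..b}"
      then show "dist (x s) (x t) \<le> B * dist s t"
        using xlip[of s t] xlip[of t s] by (cases "s \<le> t") (auto simp: dist_norm norm_minus_commute)
    qed (rule B0)
    then show ?thesis by (rule lipschitz_on_continuous_on)
  qed
  obtain D where D: "\<And>t. t \<in> {a..b} \<Longrightarrow> \<bar>p' t\<bar> \<le> D"
    using compact_imp_bounded[OF compact_continuous_image[OF p' compact_Icc]] by (fastforce simp: bounded_iff)
  then have D0: "0 \<le> D" using ab by (metis abs_ge_zero atLeastAtMost_iff order_refl order_trans)
  have plip: "\<bar>p t - p s\<bar> \<le> D * (t - s)" if "a \<le> s" "s \<le> t" "t \<le> b" for s t
  proof -
    have "norm (p t - p s) \<le> D * norm (t - s)"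
      by (rule field_differentiable_bound[of "{s..t}" p p'])
        (use that D in \<open>auto intro: DERIV_subset[OF p]\<close>)
    then show ?thesis using that by simp
  qed
  let ?h = "\<lambda>r. p' r *\<^sub>R x r + p r *\<^sub>R g r"
  have pg: "(\<lambda>r. p r *\<^sub>R g r) absolutely_integrable_on {a..b}"
  proof (rule absolutely_integrable_bounded_measurable_product[where h="(*\<^sub>R)", OF _ _ _ _ g(1)])
    show "bilinear ((*\<^sub>R) :: real \<Rightarrow> 'a \<Rightarrow> 'a)"
      by (simp add: bilinear_conv_bounded_bilinear bounded_bilinear_scaleR)
    show "bounded (p ` {a..b})"
      by (rule compact_imp_bounded[OF compact_continuous_image[OF pc compact_Icc]])
    show "p \<in> borel_measurable (lebesgue_on {a..b})"
      by (rule continuous_imp_measurable_on_sets_lebesgue[OF pc]) simp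
  qed simp
  have hint: "?h integrable_on {a..b}"
  proof (rule integrable_add)
    show "(\<lambda>r. p' r *\<^sub>R x r) integrable_on {a..b}"
      using p' xc by (intro integrable_continuous_interval continuous_intros)
    show "(\<lambda>r. p r *\<^sub>R g r) integrable_on {a..b}"
      using pg by (simp add: absolutely_integrable_on_def)
  qed
  define H where "H t = p t *\<^sub>R x t - integral {a..t} ?h" for t
  have Hd: "norm (H t - H s) \<le> (2 * D * B) * (t - s)\<^sup>2" if st: "a \<le> s" "s \<le> t" "t \<le> b" for s t
  proof -
    have i: "?h integrable_on {s..t}" "?h integrable_on {a..t}"
      using st by (auto intro!: integrable_subinterval_real[OF hint])
    have "integral {a..s} ?h + integral {s..t} ?h = integral {a..t} ?h"
      by (rule Henstock_Kurzweil_Integration.integral_combine[OF st(1,2) i(2)])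
    then have "H t - H s = p t *\<^sub>R x t - p s *\<^sub>R x s - integral {s..t} ?h"
      by (simp add: H_def algebra_simps)
    also have "\<dots> = (p t - p s) *\<^sub>R x t + p s *\<^sub>R (x t - x s) - integral {s..t} ?h"
      by (simp add: algebra_simps)
    finally have e: "H t - H s = (p t - p s) *\<^sub>R x t + p s *\<^sub>R (x t - x s) - integral {s..t} ?h" .
    have "(p' has_integral p t - p s) {s..t}"
      by (rule fundamental_theorem_of_calculus)
        (use st in \<open>auto simp: has_real_derivative_iff_has_vector_derivative[symmetric] intro: DERIV_subset[OF p]\<close>)
    then have 1: "((\<lambda>r. p' r *\<^sub>R x t) has_integral (p t - p s) *\<^sub>R x t) {s..t}"
      by (rule has_integral_scaleR_left)
    have 2: "((\<lambda>r. p s *\<^sub>R g r) has_integral p s *\<^sub>R (x t - x s)) {s..t}"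
      by (rule has_integral_cmul[OF x[OF st]])
    \<comment> \<open>Freezing \<open>x\<close> at time t and \<open>p\<close> at time s makes the
      increment of the product an exact integral; the Lipschitz bounds \<open>xlip\<close> and
      \<open>plip\<close> control the distance of its integrand from \<open>?h\<close>.\<close>
    have "((\<lambda>r. p' r *\<^sub>R x t + p s *\<^sub>R g r - ?h r) has_integral H t - H s) {s..t}"
      unfolding e by (intro has_integral_diff has_integral_add 1 2 integrable_integral i)
    moreover have "norm (p' r *\<^sub>R x t + p s *\<^sub>R g r - ?h r) \<le> 2 * D * B * (t - s)" if r: "r \<in> {s..t}" for r
    proof -
      have "p' r *\<^sub>R x t + p s *\<^sub>R g r - ?h r = p' r *\<^sub>R (x t - x r) - (p r - p s) *\<^sub>R g r"
        by (simp add: algebra_simps)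
      also have "norm \<dots> \<le> \<bar>p' r\<bar> * norm (x t - x r) + \<bar>p r - p s\<bar> * norm (g r)"
        by (metis norm_scaleR norm_triangle_ineq4)
      also have "\<dots> \<le> D * (B * (t - s)) + (D * (t - s)) * B"
      proof (intro add_mono mult_mono)
        show "norm (x t - x r) \<le> B * (t - s)"
          using xlip[of r t] r st B0 by (auto intro!: order_trans[OF xlip] mult_left_mono)
        show "\<bar>p r - p s\<bar> \<le> D * (t - s)"
          using r st D0 by (auto intro!: order_trans[OF plip] mult_left_mono)
      qed (use r st D g(2) D0 B0 in auto)
      finally show ?thesis by (simp add: algebra_simps)
    qed
    ultimately have "norm (H t - H s) \<le> 2 * D * B * (t - s) * (t - s)"
      using st D0 B0 has_integral_bound_real[of "2 * D * B * (t - s)" "{}" _ "H t - H s" s t] by simp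
    then show ?thesis by (simp add: power2_eq_square mult.assoc)
  qed
  have "(H has_vector_derivative 0) (at t within {a..b})" if t: "t \<in> {a..b}" for t
    unfolding has_vector_derivative_def has_derivative_within_alt
  proof (intro conjI allI impI)
    fix e :: real assume e: "0 < e"
    define C where "C = 2 * D * B + 1"
    have C: "0 < C" using D0 B0 by (simp add: C_def add_nonneg_pos)
    show "\<exists>del>0. \<forall>y\<in>{a..b}. norm (y - t) < del \<longrightarrow> norm (H y - H t - (y - t) *\<^sub>R 0) \<le> e * norm (y - t)"
    proof (intro exI[of _ "e / C"] conjI ballI impI)
      show "0 < e / C" using e C by simp
      fix y assume y: "y \<in> {a..b}" "norm (y - t) < e / C"
      have "norm (H y - H t) \<le> (2 * D * B) * (y - t)\<^sup>2"
        using Hd[of y t] Hd[of t y] t y by (cases "y \<le> t") (auto simp: norm_minus_commute power2_commute)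
      also have "\<dots> \<le> C * (y - t)\<^sup>2" by (intro mult_right_mono) (auto simp: C_def)
      also have "\<dots> = (C * norm (y - t)) * norm (y - t)" by (simp add: power2_eq_square)
      also have "\<dots> \<le> e * norm (y - t)"
        using y(2) C by (intro mult_right_mono) (auto simp: field_simps)
      finally show "norm (H y - H t - (y - t) *\<^sub>R 0) \<le> e * norm (y - t)" by simp
    qed
  qed simp
  then obtain k where "\<And>t. t \<in> {a..b} \<Longrightarrow> H t = k"
    using has_vector_derivative_zero_constant[of "{a..b}" H] by auto
  then have "H b = H a" using ab by auto
  then have "integral {a..b} ?h = p b *\<^sub>R x b - p a *\<^sub>R x a" by (simp add: H_def algebra_simps)
  then show ?thesis using integrable_integral[OF hint] by simp
qed

section \<open>Linear control systems\<close>

lemma has_integral_power_fact: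
  fixes K B :: real
  assumes "0 \<le> t"
  shows "((\<lambda>s. K * (B * (K * s) ^ n / fact n)) has_integral B * (K * t) ^ Suc n / fact (Suc n)) {0..t}"
proof -
  have "((\<lambda>s. B * (K * s) ^ Suc n / fact (Suc n)) has_real_derivative K * (B * (K * s) ^ n / fact n))
      (at s within {0..t})" for s
  proof -
    have "((\<lambda>s. B * (K * s) ^ Suc n / fact (Suc n)) has_real_derivative
        B * (real (Suc n) * (K * s) ^ n * K) / fact (Suc n)) (at s within {0..t})"
      by (rule derivative_eq_intros refl | simp add: mult.commute)+
    moreover have "B * (real (Suc n) * (K * s) ^ n * K) / fact (Suc n) = K * (B * (K * s) ^ n / fact n)"
      by (simp add: fact_Suc field_simps del: of_nat_Suc)
    ultimately show ?thesis by (simp only:)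
  qed
  then have "((\<lambda>s. K * (B * (K * s) ^ n / fact n)) has_integral
      B * (K * t) ^ Suc n / fact (Suc n) - B * (K * 0) ^ Suc n / fact (Suc n)) {0..t}"
    using assms by (intro fundamental_theorem_of_calculus)
      (auto simp: has_real_derivative_iff_has_vector_derivative[symmetric])
  then show ?thesis by simp
qed

text \<open>Induction on n, integrating the majorant once per step. Taking the Dyson terms for
  \<open>f\<close> gives convergence of their series; taking the constant sequence
  \<open>f n = x\<close> gives uniqueness.\<close>

lemma iterated_integral_bound:
  fixes f :: "nat \<Rightarrow> real \<Rightarrow> 'a::euclidean_space"
  assumes f0: "\<And>t. t \<in> {0..T} \<Longrightarrow> norm (f 0 t) \<le> B"
    and fS: "\<And>n t. t \<in> {0..T} \<Longrightarrow> (g n has_integral f (Suc n) t) {0..t}"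
    and g: "\<And>n t. t \<in> {0..T} \<Longrightarrow> norm (g n t) \<le> K * norm (f n t)"
    and K: "0 \<le> K" and t: "t \<in> {0..T}"
  shows "norm (f n t) \<le> B * (K * t) ^ n / fact n"
  using t
proof (induction n arbitrary: t)
  case 0 then show ?case using f0 by simp
next
  case (Suc n)
  have I: "((\<lambda>s. K * (B * (K * s) ^ n / fact n)) has_integral B * (K * t) ^ Suc n / fact (Suc n)) {0..t}"
    using Suc.prems by (intro has_integral_power_fact) simp
  have "norm (integral {0..t} (g n)) \<le> integral {0..t} (\<lambda>s. K * (B * (K * s) ^ n / fact n))"
  proof (rule integral_norm_bound_integral)
    fix s assume "s \<in> {0..t}"
    then have s: "s \<in> {0..T}" using Suc.prems by auto
    show "norm (g n s) \<le> K * (B * (K * s) ^ n / fact n)"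
      by (rule order_trans[OF g[OF s] mult_left_mono[OF Suc.IH[OF s] K]])
  qed (use fS[OF Suc.prems] I in blast)+
  then show ?case using integral_unique[OF fS[OF Suc.prems]] integral_unique[OF I] by simp
qed

locale linear_control =
  fixes c d :: "'a::euclidean_space \<Rightarrow> 'a" and a A :: real
  assumes c: "bounded_linear c" and d: "bounded_linear d"
begin

lemma control_norm_bound:
  obtains K where "0 < K" "\<And>\<alpha> t x. \<alpha> \<in> controls a A UNIV \<Longrightarrow> norm (c x + \<alpha> t *\<^sub>R d x) \<le> K * norm x"
proof -
  obtain Kc where Kc: "0 < Kc" "\<And>x. norm (c x) \<le> norm x * Kc" using bounded_linear.pos_bounded[OF c] by blast
  obtain Kd where Kd: "0 < Kd" "\<And>x. norm (d x) \<le> norm x * Kd" using bounded_linear.pos_bounded[OF d] by blast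
  show ?thesis
  proof (rule that)
    show "0 < Kc + (\<bar>a\<bar> + \<bar>A\<bar>) * Kd" using Kc Kd by (auto intro!: add_pos_nonneg)
    fix \<alpha> t x assume \<alpha>: "\<alpha> \<in> controls a A UNIV"
    have "norm (c x + \<alpha> t *\<^sub>R d x) \<le> norm (c x) + \<bar>\<alpha> t\<bar> * norm (d x)"
      by (metis norm_scaleR norm_triangle_ineq)
    also have "\<dots> \<le> norm x * Kc + (\<bar>a\<bar> + \<bar>A\<bar>) * (norm x * Kd)"
      using control_abs_le[OF \<alpha>, of t] Kc Kd by (intro add_mono mult_mono) auto
    finally show "norm (c x + \<alpha> t *\<^sub>R d x) \<le> (Kc + (\<bar>a\<bar> + \<bar>A\<bar>) * Kd) * norm x"
      by (simp add: algebra_simps)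
  qed
qed

lemma control_integrable:
  assumes "\<alpha> \<in> controls a A UNIV" "continuous_on {s..t} x"
  shows "(\<lambda>r. c (x r) + \<alpha> r *\<^sub>R d (x r)) absolutely_integrable_on {s..t}"
  using assms by (intro affine_control_integrable bounded_linear.continuous_on[OF c] bounded_linear.continuous_on[OF d])

text \<open>A solution starting at 0 is reproduced by the integral operator, so the iterated bound
  applies to it for every n, and the factorial sends that bound to 0. By linearity this is
  uniqueness.\<close>

lemma solution_zero:
  assumes \<alpha>: "\<alpha> \<in> controls a A UNIV" and x: "caratheodory {0..} c d \<alpha> x" "x 0 = 0" and t: "0 \<le> t"
  shows "x t = 0"
proof -
  obtain K where K: "0 < K" "\<And>\<alpha> t x. \<alpha> \<in> controls a A UNIV \<Longrightarrow> norm (c x + \<alpha> t *\<^sub>R d x) \<le> K * norm x"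
    using control_norm_bound by blast
  have "continuous_on {0..t} x" by (rule caratheodory_continuous_on[OF x(1)]) auto
  then have "bounded (x ` {0..t})" by (intro compact_imp_bounded compact_continuous_image) auto
  then obtain B where B: "\<And>s. s \<in> {0..t} \<Longrightarrow> norm (x s) \<le> B" by (fastforce simp: bounded_iff)
  have "norm (x t) \<le> B * (K * t) ^ n / fact n" for n
    using iterated_integral_bound[where f="\<lambda>_. x" and g="\<lambda>_ r. c (x r) + \<alpha> r *\<^sub>R d (x r)" and T=t and t=t and n=n and B=B and K=K]
      B K \<alpha> caratheodoryD[OF x(1), of 0] x(2) t by force
  moreover have "(\<lambda>n. B * (K * t) ^ n / fact n) \<longlonglongrightarrow> 0"
    using tendsto_mult_right_zero[OF summable_LIMSEQ_zero[OF summable_exp[of "K * t"]], of B]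
    by (simp add: field_simps)
  ultimately have "norm (x t) \<le> 0"
    by (intro LIMSEQ_le_const[of "\<lambda>n. B * (K * t) ^ n / fact n"]) auto
  then show ?thesis by simp
qed

lemma caratheodory_lincomb:
  assumes "caratheodory J c d \<alpha> x" "caratheodory J c d \<alpha> y"
  shows "caratheodory J c d \<alpha> (\<lambda>t. x t - k *\<^sub>R y t)"
  unfolding caratheodory_def
proof (intro ballI impI)
  interpret c: bounded_linear c by (rule c)
  interpret d: bounded_linear d by (rule d)
  fix s t assume st: "s \<in> J" "t \<in> J" "s \<le> t"
  have "((\<lambda>r. (c (x r) + \<alpha> r *\<^sub>R d (x r)) - k *\<^sub>R (c (y r) + \<alpha> r *\<^sub>R d (y r)))
      has_integral (x t - x s) - k *\<^sub>R (y t - y s)) {s..t}"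
    by (intro has_integral_diff has_integral_cmul caratheodoryD[OF assms(1)] caratheodoryD[OF assms(2)] st)
  then show "((\<lambda>r. c (x r - k *\<^sub>R y r) + \<alpha> r *\<^sub>R d (x r - k *\<^sub>R y r)) has_integral
      x t - k *\<^sub>R y t - (x s - k *\<^sub>R y s)) {s..t}"
    by (simp add: c.diff d.diff c.scaleR d.scaleR algebra_simps)
qed

section \<open>Dyson series (time-ordered exponential) for the linear control system\<close>

primrec dyson :: "(real \<Rightarrow> real) \<Rightarrow> 'a \<Rightarrow> nat \<Rightarrow> real \<Rightarrow> 'a" where
  "dyson \<alpha> w 0 = (\<lambda>t. w)"
| "dyson \<alpha> w (Suc n) = (\<lambda>t. integral {0..t} (\<lambda>r. c (dyson \<alpha> w n r) + \<alpha> r *\<^sub>R d (dyson \<alpha> w n r)))"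

context
  fixes \<alpha> :: "real \<Rightarrow> real" and w :: 'a assumes \<alpha>: "\<alpha> \<in> controls a A UNIV"
begin

lemma continuous_on_dyson: "continuous_on {0..T} (dyson \<alpha> w n)"
proof (induction n)
  case (Suc n)
  then show ?case using control_integrable[OF \<alpha> Suc]
    by (auto simp: absolutely_integrable_on_def intro!: indefinite_integral_continuous_1)
qed auto

lemma dyson_has_integral:
  "((\<lambda>r. c (dyson \<alpha> w n r) + \<alpha> r *\<^sub>R d (dyson \<alpha> w n r)) has_integral dyson \<alpha> w (Suc n) t) {0..t}"
  using control_integrable[OF \<alpha> continuous_on_dyson]
  by (auto simp: absolutely_integrable_on_def intro!: integrable_integral)

text \<open>The factorial bound gives absolute convergence and bounds the partial sums uniformly on
  bounded intervals, so dominated convergence passes to the limit in the integral equation.\<close>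

lemma dyson_sums_solution:
  shows "caratheodory {0..} c d \<alpha> (\<lambda>t. \<Sum>n. dyson \<alpha> w n t)"
    and "0 \<le> t \<Longrightarrow> (\<lambda>n. dyson \<alpha> w n t) sums (\<Sum>n. dyson \<alpha> w n t)"
    and "(\<Sum>n. dyson \<alpha> w n 0) = w"
proof -
  obtain K where K: "0 < K" "\<And>\<alpha> t x. \<alpha> \<in> controls a A UNIV \<Longrightarrow> norm (c x + \<alpha> t *\<^sub>R d x) \<le> K * norm x"
    using control_norm_bound by blast
  let ?Q = "\<lambda>r x. c x + \<alpha> r *\<^sub>R d x"
  let ?W = "\<lambda>t. \<Sum>n. dyson \<alpha> w n t"
  let ?b = "\<lambda>T n. norm w * (K * T) ^ n / fact n"
  interpret c: bounded_linear c by (rule c)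
  interpret d: bounded_linear d by (rule d)
  have bound: "norm (dyson \<alpha> w n t) \<le> ?b T n" if "0 \<le> t" "t \<le> T" for n t T
  proof -
    have "norm (dyson \<alpha> w n t) \<le> ?b t n"
      using that K(1) \<alpha> by (intro iterated_integral_bound[where T=T]) (auto intro: dyson_has_integral K(2)[OF \<alpha>] simp del: dyson.simps(2))
    also have "\<dots> \<le> ?b T n"
      using that K(1) by (intro divide_right_mono mult_left_mono power_mono) auto
    finally show ?thesis .
  qed
  have bsums: "?b T sums (norm w * exp (K * T))" for T
    using sums_mult[OF exp_converges[of "K * T"], of "norm w"] by (simp add: field_simps)
  have summ: "summable (\<lambda>n. dyson \<alpha> w n t)" if "0 \<le> t" for t
    using that bound[of t t] by (intro summable_comparison_test'[OF sums_summable[OF bsums[of t]]]) auto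
  then show sums: "0 \<le> t \<Longrightarrow> (\<lambda>n. dyson \<alpha> w n t) sums ?W t" for t by (rule summable_sums)
  have partial: "norm (\<Sum>i<n. dyson \<alpha> w i t) \<le> norm w * exp (K * T)" if "0 \<le> t" "t \<le> T" for n t T
  proof -
    have "norm (\<Sum>i<n. dyson \<alpha> w i t) \<le> (\<Sum>i<n. ?b T i)"
      using that by (intro sum_norm_le bound)
    also have "\<dots> \<le> norm w * exp (K * T)"
      using that K(1) by (intro order_trans[OF sum_le_suminf[OF sums_summable[OF bsums]]]) (auto simp: sums_unique[OF bsums, symmetric])
    finally show ?thesis .
  qed
  have "dyson \<alpha> w (Suc n) 0 = 0" for n by simp
  then have "dyson \<alpha> w n 0 = (if n = 0 then w else 0)" for n by (cases n) auto
  then show W0: "?W 0 = w" using suminf_finite[of "{0}" "\<lambda>n. dyson \<alpha> w n 0"] by simp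
  show "caratheodory {0..} c d \<alpha> ?W"
  proof (rule caratheodoryI0)
    fix t :: real assume "t \<in> {0..}"
    then have t: "0 \<le> t" by simp
    \<comment> \<open>Integration shifts the index: the terms 0 to n - 1 go to the terms 1 to n,
      whose sum tends to the full series minus its term of index 0, which is
      \<open>w\<close>.\<close>
    have int: "((\<lambda>r. ?Q r (\<Sum>i<n. dyson \<alpha> w i r)) has_integral (\<Sum>i<n. dyson \<alpha> w (Suc i) t)) {0..t}" for n
    proof -
      have "((\<lambda>r. \<Sum>i<n. ?Q r (dyson \<alpha> w i r)) has_integral (\<Sum>i<n. dyson \<alpha> w (Suc i) t)) {0..t}"
        by (intro has_integral_sum dyson_has_integral) auto
      then show ?thesis by (simp add: c.sum d.sum sum.distrib scaleR_sum_right)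
    qed
    have bd: "norm (?Q r (\<Sum>i<n. dyson \<alpha> w i r)) \<le> K * (norm w * exp (K * t))" if "r \<in> {0..t}" for n r
      using that K(1) by (intro order_trans[OF K(2)[OF \<alpha>]] mult_left_mono partial) auto
    have lim: "(\<lambda>n. ?Q r (\<Sum>i<n. dyson \<alpha> w i r)) \<longlonglongrightarrow> ?Q r (?W r)" if "r \<in> {0..t}" for r
      using sums[of r] that by (intro tendsto_intros c.tendsto d.tendsto) (auto simp: sums_def)
    note dc = dominated_convergence[OF has_integral_integrable[OF int] integrable_const_ivl bd lim]
    have "(\<lambda>n. \<Sum>i<n. dyson \<alpha> w (Suc i) t) \<longlonglongrightarrow> ?W t - w"
    proof -
      have "(\<lambda>n. (\<Sum>i<Suc n. dyson \<alpha> w i t) - w) \<longlonglongrightarrow> ?W t - w"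
        using sums[OF t] by (intro tendsto_intros) (auto simp: sums_def simp del: sum.lessThan_Suc intro: LIMSEQ_Suc)
      then show ?thesis by (simp add: sum.lessThan_Suc_shift del: sum.lessThan_Suc dyson.simps(2))
    qed
    then have "integral {0..t} (\<lambda>r. ?Q r (?W r)) = ?W t - w"
      using dc(2) integral_unique[OF int] LIMSEQ_unique by (simp del: dyson.simps(2))
    then show "((\<lambda>r. ?Q r (?W r)) has_integral ?W t - ?W 0) {0..t}"
      using integrable_integral[OF dc(1)] W0 by simp
  qed auto
qed

end

lemma solution_exists:
  assumes "\<alpha> \<in> controls a A UNIV"
  obtains x where "caratheodory {0..} c d \<alpha> x" "x 0 = w"
  using dyson_sums_solution(1,3)[OF assms] by blast

text \<open>The cone is cut out by the functionals in \<open>U\<close>, which commute with integrals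
  and convergent sums. Each Dyson term stays in the cone because the right-hand side maps the cone
  into itself; uniqueness identifies \<open>x\<close> with the Dyson sum.\<close>

lemma solution_in_dual_cone:
  assumes \<alpha>: "\<alpha> \<in> controls a A UNIV" and x: "caratheodory {0..} c d \<alpha> x" and t: "0 \<le> t"
    and x0: "\<forall>u\<in>U. 0 \<le> u \<bullet> x 0"
    and inv: "\<And>s v. \<forall>u\<in>U. 0 \<le> u \<bullet> v \<Longrightarrow> \<forall>u\<in>U. 0 \<le> u \<bullet> (c v + \<alpha> s *\<^sub>R d v)"
  shows "\<forall>u\<in>U. 0 \<le> u \<bullet> x t"
proof
  fix u assume u: "u \<in> U"
  let ?W = "\<lambda>t. \<Sum>n. dyson \<alpha> (x 0) n t"
  have dn: "\<forall>u\<in>U. 0 \<le> u \<bullet> dyson \<alpha> (x 0) n s" for n s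
  proof (induction n arbitrary: s)
    case (Suc n)
    show ?case
    proof
      fix u assume u: "u \<in> U"
      have "((\<lambda>r. u \<bullet> (c (dyson \<alpha> (x 0) n r) + \<alpha> r *\<^sub>R d (dyson \<alpha> (x 0) n r))) has_integral
          u \<bullet> dyson \<alpha> (x 0) (Suc n) s) {0..s}"
        using has_integral_linear[OF dyson_has_integral[OF \<alpha>] bounded_linear_inner_right[of u]] by (simp only: o_def)
      then show "0 \<le> u \<bullet> dyson \<alpha> (x 0) (Suc n) s"
        by (rule has_integral_nonneg) (use inv[OF Suc] u in blast)
    qed
  qed (use x0 in simp)
  have "x t - 1 *\<^sub>R ?W t = 0"
    using dyson_sums_solution(1,3)[OF \<alpha>, of "x 0"]
    by (intro solution_zero[OF \<alpha> caratheodory_lincomb[OF x] _ t]) auto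
  moreover have "(\<lambda>n. u \<bullet> dyson \<alpha> (x 0) n t) sums (u \<bullet> ?W t)"
    by (rule bounded_linear.sums[OF bounded_linear_inner_right dyson_sums_solution(2)[OF \<alpha> t]])
  then have "0 \<le> u \<bullet> ?W t"
    using dn u sums_le[OF _ sums_zero] by (metis (no_types, lifting))
  ultimately show "0 \<le> u \<bullet> x t" by simp
qed

end

section \<open>The flow on the simplex\<close>

lemma integral_continuous_has_real_derivative:
  fixes f :: "real \<Rightarrow> real"
  assumes "continuous_on {0..b} f" "t \<in> {0..b}"
  shows "((\<lambda>t. integral {0..t} f) has_real_derivative f t) (at t within {0..b})"
  using integral_has_vector_derivative[OF assms]
  by (simp add: has_real_derivative_iff_has_vector_derivative)

text \<open>The left end \<open>a\<close> is singled out because F is nonnegative off the diagonal: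
  among the matrices G + \<alpha> F with \<alpha> in [a, A], the one at \<open>a\<close> has the
  smallest off-diagonal entries.\<close>

locale simplex_control =
  fixes G F :: "real^3^3" and m :: "real^3" and a A :: real
  assumes G: "nonneg_off_diagonal G" and F: "nonneg_off_diagonal F"
    and m: "\<forall>i. 0 < m $ i" and mF: "m v* F = 0"
    and a: "0 \<le> a" and irred: "irreducible_matrix (G + a *\<^sub>R F)"
begin

abbreviation S :: "(real^3) set" where "S \<equiv> simplex_m m"
abbreviation L :: "real^3 \<Rightarrow> real" where "L \<equiv> payoff G m"

text \<open>Large enough that every diagonal entry of \<mu> I + G + \<alpha> F is nonnegative for
  \<alpha> in [a, A]. The shift only multiplies linear solutions by exp(\<mu> t), and it makes the
  matrix itself preserve the positive cone.\<close>

definition \<mu> :: real where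
  "\<mu> = (\<Sum>i\<in>UNIV. \<bar>G $ i $ i\<bar> + (\<bar>a\<bar> + \<bar>A\<bar>) * \<bar>F $ i $ i\<bar>)"

text \<open>A control-free nonnegative matrix lying entrywise below every \<mu> I + G + \<alpha> F
  with \<alpha> in [a, A]; all lower bounds on the flow are expressed through it.\<close>

definition N :: "real^3^3" where
  "N = (\<chi> i j. if i = j then 0 else (G + a *\<^sub>R F) $ i $ j)"

sublocale lin: linear_control "\<lambda>v. \<mu> *\<^sub>R v + G *v v" "\<lambda>v. F *v v" a A
  by (intro linear_control.intro bounded_linear_add bounded_linear_scaleR_right matrix_vector_mul_bounded_linear)

definition solution :: "real set \<Rightarrow> (real \<Rightarrow> real) \<Rightarrow> (real \<Rightarrow> real^3) \<Rightarrow> bool" where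
  "solution J \<alpha> y \<longleftrightarrow> \<alpha> \<in> controls a A UNIV \<and>
     caratheodory J (\<lambda>v. G *v v - L v *\<^sub>R v) (\<lambda>v. F *v v) \<alpha> y \<and> (\<forall>t\<in>J. y t \<in> S)"

lemma m_F [simp]: "m \<bullet> (F *v v) = 0"
  using dot_lmul_matrix[of m F v] mF by simp

lemma continuous_on_payoff [continuous_intros]:
  "continuous_on J y \<Longrightarrow> continuous_on J (\<lambda>t. L (y t))"
  unfolding payoff_def
  by (intro continuous_intros bounded_linear.continuous_on[OF matrix_vector_mul_bounded_linear])

lemma continuous_on_field_b [continuous_intros]:
  assumes "continuous_on J y"
  shows "continuous_on J (\<lambda>t. G *v y t - L (y t) *\<^sub>R y t)" "continuous_on J (\<lambda>t. F *v y t)"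
  using assms by (intro continuous_intros bounded_linear.continuous_on[OF matrix_vector_mul_bounded_linear]; simp)+

lemma simplex_component_le:
  assumes "y \<in> S" shows "y $ i \<le> 1 / m $ i"
proof -
  have "m $ i * y $ i \<le> (\<Sum>i\<in>UNIV. m $ i * y $ i)"
    using assms m by (intro member_le_sum) (auto simp: simplex_m_def less_imp_le)
  also have "\<dots> = 1" using assms by (simp add: simplex_m_def inner_vec_def)
  finally show ?thesis using m by (simp add: field_simps)
qed

lemma simplex_norm_bound: obtains B where "0 < B" "\<And>y. y \<in> S \<Longrightarrow> norm y \<le> B"
proof
  show "0 < (\<Sum>i\<in>UNIV. 1 / m $ i)" using m by (intro sum_pos) auto
  fix y assume y: "y \<in> S"
  have "norm y \<le> (\<Sum>i\<in>UNIV. \<bar>y $ i\<bar>)" by (rule norm_le_l1_cart)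
  also have "\<dots> \<le> (\<Sum>i\<in>UNIV. 1 / m $ i)"
    using y simplex_component_le[OF y] by (intro sum_mono) (auto simp: simplex_m_def)
  finally show "norm y \<le> (\<Sum>i\<in>UNIV. 1 / m $ i)" .
qed

lemma payoff_bound: obtains K where "0 < K" "\<And>y. y \<in> S \<Longrightarrow> \<bar>L y\<bar> \<le> K"
proof -
  obtain B where B: "0 < B" "\<And>y. y \<in> S \<Longrightarrow> norm y \<le> B" using simplex_norm_bound by blast
  obtain C where C: "0 < C" "\<And>y. norm (G *v y) \<le> norm y * C"
    using bounded_linear.pos_bounded[OF matrix_vector_mul_bounded_linear[of G]] by blast
  show ?thesis
  proof
    show "0 < norm m * (B * C) + 1" using B C by (intro add_nonneg_pos) auto
    fix y assume "y \<in> S"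
    then have "\<bar>L y\<bar> \<le> norm m * (B * C)"
      unfolding payoff_def using B C
      by (intro order_trans[OF Cauchy_Schwarz_ineq2] mult_left_mono order_trans[OF C(2)] mult_right_mono) auto
    then show "\<bar>L y\<bar> \<le> norm m * (B * C) + 1" by simp
  qed
qed

text \<open>On the diagonal the choice of \<open>\<mu>\<close> gives nonnegativity; off the diagonal
  the entries increase with the control. The entrywise comparison survives multiplication by v
  because v is nonnegative.\<close>

lemma off_diagonal_le_shifted:
  assumes \<alpha>: "\<alpha> \<in> controls a A UNIV" and v: "\<And>i. 0 \<le> v $ i"
  shows "(N *v v) $ i \<le> (\<mu> *\<^sub>R v + G *v v + \<alpha> t *\<^sub>R (F *v v)) $ i"
proof -
  have al: "a \<le> \<alpha> t" using \<alpha> by (auto simp: controls_def)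
  have "(N *v v) $ i = (\<Sum>j\<in>UNIV. N $ i $ j * v $ j)" by (simp add: matrix_vector_mult_def)
  also have "\<dots> \<le> (\<Sum>j\<in>UNIV. ((if i = j then \<mu> else 0) + G $ i $ j + \<alpha> t * F $ i $ j) * v $ j)"
  proof (intro sum_mono mult_right_mono v)
    fix j
    show "N $ i $ j \<le> (if i = j then \<mu> else 0) + G $ i $ j + \<alpha> t * F $ i $ j"
    proof (cases "i = j")
      case True
      have "\<bar>\<alpha> t\<bar> * \<bar>F $ i $ i\<bar> \<le> (\<bar>a\<bar> + \<bar>A\<bar>) * \<bar>F $ i $ i\<bar>"
        by (intro mult_right_mono control_abs_le[OF \<alpha>]) auto
      moreover have "\<bar>G $ i $ i\<bar> + (\<bar>a\<bar> + \<bar>A\<bar>) * \<bar>F $ i $ i\<bar> \<le> \<mu>"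
        unfolding \<mu>_def
        by (rule member_le_sum[where f="\<lambda>i. \<bar>G $ i $ i\<bar> + (\<bar>a\<bar> + \<bar>A\<bar>) * \<bar>F $ i $ i\<bar>"]) auto
      moreover have "\<bar>\<alpha> t * F $ i $ i\<bar> = \<bar>\<alpha> t\<bar> * \<bar>F $ i $ i\<bar>" by (rule abs_mult)
      ultimately have "0 \<le> \<mu> + G $ i $ i + \<alpha> t * F $ i $ i" by linarith
      then show ?thesis using True by (simp add: N_def)
    next
      case False
      have "a * F $ i $ j \<le> \<alpha> t * F $ i $ j"
        using al F False by (intro mult_right_mono) (auto simp: nonneg_off_diagonal_def)
      then show ?thesis using False by (simp add: N_def)
    qed
  qed
  also have "\<dots> = (\<mu> *\<^sub>R v + G *v v + \<alpha> t *\<^sub>R (F *v v)) $ i"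
  proof -
    have "(if i = j then \<mu> else 0) * v $ j = (if i = j then \<mu> * v $ j else 0)" for j by simp
    then show ?thesis
      by (simp add: matrix_vector_mult_def distrib_right sum.distrib sum_distrib_left mult.assoc)
  qed
  finally show ?thesis .
qed

lemma field_b_affine: "field_b G F m y \<beta> = (G *v y - L y *\<^sub>R y) + \<beta> *\<^sub>R (F *v y)"
  by (simp add: field_b_def payoff_def matrix_vector_mult_add_rdistrib scaleR_matrix_vector_assoc)

text \<open>Bridge between the problem's notion of trajectory and \<open>solution\<close>. The
  conditions on \<open>J\<close> cover both the finite and the infinite horizon.\<close>

lemma trajectory_iff_solution:
  assumes \<alpha>: "\<alpha> \<in> controls a A UNIV" and J: "0 \<in> J" "J \<subseteq> {0..}" "\<And>t. t \<in> J \<Longrightarrow> {0..t} \<subseteq> J"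
  shows "trajectory G F m J \<alpha> y0 y \<longleftrightarrow> solution J \<alpha> y \<and> y 0 = y0"
proof
  assume tr: "trajectory G F m J \<alpha> y0 y"
  have y0: "y 0 = y0" using tr J(1) by (auto simp: trajectory_def)
  have "caratheodory J (\<lambda>v. G *v v - L v *\<^sub>R v) (\<lambda>v. F *v v) \<alpha> y"
  proof (rule caratheodoryI0[OF _ J(2)])
    fix t assume "t \<in> J"
    then have "(\<lambda>s. field_b G F m (y s) (\<alpha> s)) integrable_on {0..t}"
      "y t = y0 + integral {0..t} (\<lambda>s. field_b G F m (y s) (\<alpha> s))"
      using tr by (auto simp: trajectory_def absolutely_integrable_on_def)
    then have "((\<lambda>s. field_b G F m (y s) (\<alpha> s)) has_integral (y t - y 0)) {0..t}"
      using y0 integrable_integral by fastforce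
    then show "((\<lambda>s. (G *v y s - L (y s) *\<^sub>R y s) + \<alpha> s *\<^sub>R (F *v y s)) has_integral (y t - y 0)) {0..t}"
      by (simp add: field_b_affine)
  qed
  then show "solution J \<alpha> y \<and> y 0 = y0"
    using tr \<alpha> y0 by (auto simp: solution_def trajectory_def)
next
  assume *: "solution J \<alpha> y \<and> y 0 = y0"
  then have y: "caratheodory J (\<lambda>v. G *v v - L v *\<^sub>R v) (\<lambda>v. F *v v) \<alpha> y" by (simp add: solution_def)
  show "trajectory G F m J \<alpha> y0 y"
    unfolding trajectory_def
  proof (intro ballI conjI)
    fix t assume t: "t \<in> J"
    show "y t \<in> S" using * t by (simp add: solution_def)
    have "continuous_on {0..t} y" by (rule caratheodory_continuous_on[OF y J(3)[OF t]])
    then show "(\<lambda>s. field_b G F m (y s) (\<alpha> s)) absolutely_integrable_on {0..t}"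
      unfolding field_b_affine by (intro affine_control_integrable[OF \<alpha>] continuous_on_field_b)
    show "y t = y0 + integral {0..t} (\<lambda>s. field_b G F m (y s) (\<alpha> s))"
      using caratheodoryD[OF y J(1) t] J(2) t * by (auto simp: field_b_affine integral_unique)
  qed
qed

lemma solution_continuous_on: "solution {0..} \<alpha> y \<Longrightarrow> continuous_on {0..} y"
  by (auto simp: solution_def intro: caratheodory_continuous_on_atLeast)

lemma solution_shift:
  "solution {0..} \<alpha> y \<Longrightarrow> 0 \<le> T \<Longrightarrow> solution {0..} (\<lambda>t. \<alpha> (T + t)) (\<lambda>t. y (T + t))"
  by (auto simp: solution_def intro: controls_shift caratheodory_shift)

lemma solution_concat:
  assumes "solution {0..T} \<alpha> x" "solution {0..} \<beta> z" "0 \<le> T" "z 0 = x T"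
  shows "solution {0..} (\<lambda>t. if t < T then \<alpha> t else \<beta> (t - T)) (\<lambda>t. if t < T then x t else z (t - T))"
proof -
  have "(\<lambda>t. if t < T then \<alpha> t else \<beta> (t - T)) \<in> controls a A UNIV"
    using assms controls_shift[of \<beta> a A "- T"] by (intro controls_concat) (auto simp: solution_def)
  then show ?thesis
    using assms caratheodory_concat[of T _ _ \<alpha> x \<beta> z] by (auto simp: solution_def)
qed

text \<open>Along a solution on the simplex, \<^term>\<open>mass\<close> is the total mass
  \<^term>\<open>m \<bullet> W t\<close> of the corresponding solution \<open>W\<close> of the linear system, whose
  growth rate is the payoff (plus the shift \<^term>\<open>\<mu>\<close>).\<close>

definition mass :: "(real \<Rightarrow> real^3) \<Rightarrow> real \<Rightarrow> real" where
  "mass y t = exp (\<mu> * t + integral {0..t} (\<lambda>s. L (y s)))"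

lemma mass_pos: "0 < mass y t" by (simp add: mass_def)

lemma mass_has_derivative:
  assumes y: "continuous_on {0..} y" and t: "t \<in> {0..b}"
  shows "(mass y has_real_derivative (\<mu> + L (y t)) * mass y t) (at t within {0..b})"
proof -
  have c: "continuous_on {0..b} (\<lambda>s. L (y s))"
    using y by (intro continuous_intros) (auto intro: continuous_on_subset)
  show ?thesis
    unfolding mass_def[abs_def]
    by (rule derivative_eq_intros integral_continuous_has_real_derivative[OF c t] refl | simp)+
qed

text \<open>Differentiating the factor \<open>mass y\<close> produces L(y) y, which cancels the
  quadratic term of the equation on the simplex and leaves a linear equation.\<close>

lemma solution_linear:
  assumes sol: "solution {0..} \<alpha> y"
  shows "caratheodory {0..} (\<lambda>v. \<mu> *\<^sub>R v + G *v v) (\<lambda>v. F *v v) \<alpha> (\<lambda>t. mass y t *\<^sub>R y t)"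
proof (rule caratheodoryI0)
  fix t :: real assume "t \<in> {0..}"
  then have t: "0 \<le> t" by simp
  have \<alpha>: "\<alpha> \<in> controls a A UNIV" and S: "\<And>t. 0 \<le> t \<Longrightarrow> y t \<in> S"
    and y: "caratheodory {0..} (\<lambda>v. G *v v - L v *\<^sub>R v) (\<lambda>v. F *v v) \<alpha> y"
    using sol by (auto simp: solution_def)
  have cont: "continuous_on {0..} y" by (rule solution_continuous_on[OF sol])
  have cont': "continuous_on {0..t} y" by (rule continuous_on_subset[OF cont]) auto
  let ?g = "\<lambda>r. (G *v y r - L (y r) *\<^sub>R y r) + \<alpha> r *\<^sub>R (F *v y r)"
  let ?b = "\<lambda>r. norm (G *v y r - L (y r) *\<^sub>R y r) + (\<bar>a\<bar> + \<bar>A\<bar>) * norm (F *v y r)"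
  \<comment> \<open>Replacing the control by its bound makes \<open>?b\<close> continuous, so
    compactness yields the velocity bound that the product rule asks for.\<close>
  have "continuous_on {0..t} ?b"
    by (intro continuous_intros cont')
  then have "bounded (?b ` {0..t})"
    by (rule compact_imp_bounded[OF compact_continuous_image[OF _ compact_Icc]])
  then obtain B where "\<forall>x\<in>?b ` {0..t}. norm x \<le> B"
    unfolding bounded_iff by blast
  then have B: "?b r \<le> B" if "r \<in> {0..t}" for r using that by (simp add: abs_le_iff)
  have g: "norm (?g r) \<le> B" if "r \<in> {0..t}" for r
  proof -
    have "norm (?g r) \<le> norm (G *v y r - L (y r) *\<^sub>R y r) + \<bar>\<alpha> r\<bar> * norm (F *v y r)"
      by (metis norm_scaleR norm_triangle_ineq)
    also have "\<dots> \<le> norm (G *v y r - L (y r) *\<^sub>R y r) + (\<bar>a\<bar> + \<bar>A\<bar>) * norm (F *v y r)"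
      by (intro add_left_mono mult_right_mono control_abs_le[OF \<alpha>]) auto
    finally show ?thesis using B[OF that] by (rule order_trans)
  qed
  have "((\<lambda>r. ((\<mu> + L (y r)) * mass y r) *\<^sub>R y r + mass y r *\<^sub>R ?g r) has_integral
      mass y t *\<^sub>R y t - mass y 0 *\<^sub>R y 0) {0..t}"
  proof (rule has_integral_scaleR_product[OF mass_has_derivative[OF cont]])
    show "continuous_on {0..t} (\<lambda>r. (\<mu> + L (y r)) * mass y r)"
      by (intro continuous_intros cont' DERIV_continuous_on[OF mass_has_derivative[OF cont]])
    show "?g absolutely_integrable_on {0..t}"
      by (intro affine_control_integrable[OF \<alpha>] continuous_on_field_b cont')
    show "(?g has_integral y r - y s) {s..r}" if "0 \<le> s" "s \<le> r" "r \<le> t" for s r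
      using that by (intro caratheodoryD[OF y]) auto
  qed (use g t in auto)
  moreover have "((\<mu> + L (y r)) * mass y r) *\<^sub>R y r + mass y r *\<^sub>R ?g r
    = \<mu> *\<^sub>R (mass y r *\<^sub>R y r) + G *v (mass y r *\<^sub>R y r) + \<alpha> r *\<^sub>R (F *v (mass y r *\<^sub>R y r))" for r
    by (simp add: matrix_vector_mult_scaleR algebra_simps)
  ultimately show "((\<lambda>r. \<mu> *\<^sub>R (mass y r *\<^sub>R y r) + G *v (mass y r *\<^sub>R y r) + \<alpha> r *\<^sub>R (F *v (mass y r *\<^sub>R y r)))
      has_integral mass y t *\<^sub>R y t - mass y 0 *\<^sub>R y 0) {0..t}"
    by simp
qed auto

lemma N_nonneg: "0 \<le> N $ i $ j"
  using G F a by (simp add: N_def nonneg_off_diagonal_def)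

lemma N_mult_nonneg: "(\<And>j. 0 \<le> v $ j) \<Longrightarrow> 0 \<le> (N *v v) $ i"
  using N_nonneg by (auto simp: matrix_vector_mult_def intro!: sum_nonneg)

lemma shifted_nonneg:
  assumes "\<alpha> \<in> controls a A UNIV" "\<And>j. 0 \<le> v $ j"
  shows "0 \<le> (\<mu> *\<^sub>R v + G *v v + \<alpha> t *\<^sub>R (F *v v)) $ i"
  by (rule order_trans[OF N_mult_nonneg off_diagonal_le_shifted[OF assms(1)]]) (rule assms(2))+

text \<open>The positive orthant is the dual cone of the coordinate vectors, and the shifted
  right-hand side maps it into itself.\<close>

lemma linear_solution_nonneg:
  assumes \<alpha>: "\<alpha> \<in> controls a A UNIV"
    and W: "caratheodory {0..} (\<lambda>v. \<mu> *\<^sub>R v + G *v v) (\<lambda>v. F *v v) \<alpha> W"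
    and W0: "\<And>i. 0 \<le> W 0 $ i" and t: "0 \<le> t"
  shows "0 \<le> W t $ i"
proof -
  have "\<forall>u\<in>range (\<lambda>i. axis i 1). 0 \<le> u \<bullet> W t"
  proof (rule lin.solution_in_dual_cone[OF \<alpha> W t])
    show "\<forall>u\<in>range (\<lambda>i. axis i 1). 0 \<le> u \<bullet> (\<mu> *\<^sub>R v + G *v v + \<alpha> s *\<^sub>R (F *v v))"
      if "\<forall>u\<in>range (\<lambda>i. axis i 1). 0 \<le> u \<bullet> v" for s v
      using that shifted_nonneg[OF \<alpha>, of v s] by (auto simp: inner_axis')
  qed (use W0 in \<open>auto simp: inner_axis'\<close>)
  then show ?thesis by (auto simp: inner_axis')
qed

end

section \<open>Monotonicity, growth and normalisation of nonnegative linear solutions\<close>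

context simplex_control
begin

context
  fixes \<alpha> W
  assumes \<alpha>: "\<alpha> \<in> controls a A UNIV"
    and W: "caratheodory {0..} (\<lambda>v. \<mu> *\<^sub>R v + G *v v) (\<lambda>v. F *v v) \<alpha> W"
    and W0: "\<And>i. 0 \<le> W 0 $ i"
begin

lemma linear_solution_has_integral_component:
  assumes "0 \<le> s" "s \<le> t"
  shows "((\<lambda>r. (\<mu> *\<^sub>R W r + G *v W r + \<alpha> r *\<^sub>R (F *v W r)) $ i) has_integral W t $ i - W s $ i) {s..t}"
  using has_integral_linear[OF caratheodoryD[OF W, of s t] bounded_linear_vec_nth[of i]] assms
  by (simp add: o_def)

text \<open>Thanks to the shift, the velocity has nonnegative coordinates throughout the
  cone.\<close>

lemma linear_solution_mono:
  assumes "0 \<le> s" "s \<le> t"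
  shows "W s $ i \<le> W t $ i"
proof -
  have "0 \<le> W t $ i - W s $ i"
    by (rule has_integral_nonneg[OF linear_solution_has_integral_component[OF assms]])
      (use assms in \<open>auto intro!: shifted_nonneg[OF \<alpha>, simplified] linear_solution_nonneg[OF \<alpha> W W0]\<close>)
  then show ?thesis by simp
qed

text \<open>One explicit Euler step with \<open>N\<close> is a lower bound for the flow: by
  monotonicity \<open>N *v W r\<close> stays above its value at time s.\<close>

lemma linear_solution_growth:
  assumes "0 \<le> s" "s \<le> t"
  shows "W s $ i + (t - s) * (N *v W s) $ i \<le> W t $ i"
proof -
  have "((\<lambda>r. (N *v W s) $ i) has_integral (t - s) * (N *v W s) $ i) {s..t}"
    using has_integral_const_real[of "(N *v W s) $ i" s t] assms by simp
  then have "(t - s) * (N *v W s) $ i \<le> W t $ i - W s $ i"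
  proof (rule has_integral_le[OF _ linear_solution_has_integral_component[OF assms]])
    fix r assume r: "r \<in> {s..t}"
    have "(N *v W s) $ i \<le> (N *v W r) $ i"
      using r assms N_nonneg linear_solution_mono[of s r]
      by (auto simp: matrix_vector_mult_def intro!: sum_mono mult_left_mono)
    also have "\<dots> \<le> (\<mu> *\<^sub>R W r + G *v W r + \<alpha> r *\<^sub>R (F *v W r)) $ i"
      using r assms by (intro off_diagonal_le_shifted[OF \<alpha>] linear_solution_nonneg[OF \<alpha> W W0]) auto
    finally show "(N *v W s) $ i \<le> (\<mu> *\<^sub>R W r + G *v W r + \<alpha> r *\<^sub>R (F *v W r)) $ i" .
  qed
  then show ?thesis by simp
qed

text \<open>Pairing with m kills the control term, so the total mass is differentiable at every time
  even though \<open>W\<close> need not be. The lower bound 1 later makes division by the mass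
  safe.\<close>

lemma linear_solution_mass:
  assumes "W 0 \<in> S" "0 \<le> t"
  shows "1 \<le> m \<bullet> W t"
    and "\<And>b. t \<in> {0..b} \<Longrightarrow>
      ((\<lambda>t. m \<bullet> W t) has_real_derivative \<mu> * (m \<bullet> W t) + L (W t)) (at t within {0..b})"
proof -
  have "m \<bullet> W 0 \<le> m \<bullet> W t"
    using linear_solution_mono[of 0 t] m assms(2)
    by (auto simp: inner_vec_def less_imp_le intro!: sum_mono mult_left_mono)
  then show "1 \<le> m \<bullet> W t" using assms(1) by (simp add: simplex_m_def)
  fix b assume t: "t \<in> {0..b}"
  let ?f = "\<lambda>r. \<mu> * (m \<bullet> W r) + L (W r)"
  have eq: "m \<bullet> W s = m \<bullet> W 0 + integral {0..s} ?f" if "0 \<le> s" for s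
  proof -
    have "((\<lambda>r. m \<bullet> (\<mu> *\<^sub>R W r + G *v W r + \<alpha> r *\<^sub>R (F *v W r))) has_integral m \<bullet> (W s - W 0)) {0..s}"
      using has_integral_linear[OF caratheodoryD[OF W, of 0 s] bounded_linear_inner_right[of m]] that
      by (simp add: o_def)
    then have "(?f has_integral m \<bullet> W s - m \<bullet> W 0) {0..s}"
      by (simp add: inner_add_right inner_diff_right payoff_def)
    then show ?thesis by (simp add: integral_unique)
  qed
  have "continuous_on {0..b} ?f"
    by (intro continuous_intros caratheodory_continuous_on[OF W]) auto
  from integral_continuous_has_real_derivative[OF this t]
  have "((\<lambda>s. m \<bullet> W 0 + integral {0..s} ?f) has_real_derivative ?f t) (at t within {0..b})"
    by (auto intro!: derivative_eq_intros)
  then show "((\<lambda>s. m \<bullet> W s) has_real_derivative ?f t) (at t within {0..b})"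
    by (rule has_field_derivative_transform_within[OF _ zero_less_one t]) (use eq[symmetric] in auto)
qed

text \<open>The converse of \<open>solution_linear\<close>: the product rule with factor 1 / (m
  \<bullet> W) restores the quadratic term.\<close>

lemma linear_solution_normalized:
  assumes "W 0 \<in> S"
  shows "solution {0..} \<alpha> (\<lambda>t. (1 / (m \<bullet> W t)) *\<^sub>R W t)"
  unfolding solution_def
proof (intro conjI ballI caratheodoryI0 \<alpha>)
  let ?n = "\<lambda>t. m \<bullet> W t"
  let ?y = "\<lambda>t. (1 / ?n t) *\<^sub>R W t"
  have n: "1 \<le> ?n t" if "0 \<le> t" for t using linear_solution_mass(1)[OF assms that] .
  fix t :: real assume "t \<in> {0..}"
  then have t: "0 \<le> t" by simp
  show "?y t \<in> S"
    using n[OF t] linear_solution_nonneg[OF \<alpha> W W0 t] by (auto simp: simplex_m_def)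
  have cont: "continuous_on {0..t} W" by (rule caratheodory_continuous_on[OF W]) auto
  let ?g = "\<lambda>r. \<mu> *\<^sub>R W r + G *v W r + \<alpha> r *\<^sub>R (F *v W r)"
  obtain K where K: "0 < K" "\<And>t x. norm (\<mu> *\<^sub>R x + G *v x + \<alpha> t *\<^sub>R (F *v x)) \<le> K * norm x"
    using lin.control_norm_bound \<alpha> by metis
  have "bounded (W ` {0..t})"
    by (rule compact_imp_bounded[OF compact_continuous_image[OF cont compact_Icc]])
  then obtain B where B: "\<forall>x\<in>W ` {0..t}. norm x \<le> B" unfolding bounded_iff by blast
  have "((\<lambda>r. (- (\<mu> * ?n r + L (W r)) / (?n r)\<^sup>2) *\<^sub>R W r + (1 / ?n r) *\<^sub>R ?g r) has_integral ?y t - ?y 0) {0..t}"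
  proof (rule has_integral_scaleR_product)
    fix r assume r: "r \<in> {0..t}"
    then have "?n r \<noteq> 0" using n[of r] by auto
    then show "((\<lambda>r. 1 / ?n r) has_real_derivative - (\<mu> * ?n r + L (W r)) / (?n r)\<^sup>2) (at r within {0..t})"
      using linear_solution_mass(2)[OF assms _ r] r
      by (auto intro!: derivative_eq_intros simp: power2_eq_square)
    show "norm (?g r) \<le> K * B"
      using K(1) B r by (intro order_trans[OF K(2)] mult_left_mono) auto
  next
    show "continuous_on {0..t} (\<lambda>r. - (\<mu> * ?n r + L (W r)) / (?n r)\<^sup>2)"
      using n by (intro continuous_intros cont) (fastforce simp: not_le[symmetric])
    show "?g absolutely_integrable_on {0..t}"
      by (rule lin.control_integrable[OF \<alpha> cont])
    show "(?g has_integral W r - W s) {s..r}" if "0 \<le> s" "s \<le> r" "r \<le> t" for s r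
      using that by (intro caratheodoryD[OF W]) auto
  qed (rule t)
  then show "((\<lambda>r. G *v ?y r - L (?y r) *\<^sub>R ?y r + \<alpha> r *\<^sub>R (F *v ?y r)) has_integral ?y t - ?y 0) {0..t}"
  proof (rule has_integral_eq[rotated])
    fix r assume "r \<in> {0..t}"
    then have nr: "?n r \<noteq> 0" using n[of r] by auto
    have "L (?y r) = L (W r) / ?n r"
      by (simp add: payoff_def matrix_vector_mult_scaleR)
    then have "G *v ?y r - L (?y r) *\<^sub>R ?y r + \<alpha> r *\<^sub>R (F *v ?y r)
       = (1 / ?n r) *\<^sub>R (G *v W r + \<alpha> r *\<^sub>R (F *v W r)) - (L (W r) / (?n r)\<^sup>2) *\<^sub>R W r"
      by (simp add: matrix_vector_mult_scaleR power2_eq_square algebra_simps)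
    \<comment> \<open>The shift drops out: the contribution of \<open>\<mu>\<close> to the
      derivative of the factor cancels the one in \<open>?g\<close>.\<close>
    also have "\<dots> = (- (\<mu> * ?n r + L (W r)) / (?n r)\<^sup>2) *\<^sub>R W r + (1 / ?n r) *\<^sub>R ?g r"
    proof -
      have "- (\<mu> * ?n r + L (W r)) / (?n r)\<^sup>2 = - (\<mu> / ?n r) - L (W r) / (?n r)\<^sup>2"
        using nr by (simp add: field_simps power2_eq_square)
      then show ?thesis
        unfolding \<open>- (\<mu> * ?n r + L (W r)) / (?n r)\<^sup>2 = - (\<mu> / ?n r) - L (W r) / (?n r)\<^sup>2\<close>
        by (simp add: scaleR_diff_left scaleR_add_right)
    qed
    finally show "(- (\<mu> * ?n r + L (W r)) / (?n r)\<^sup>2) *\<^sub>R W r + (1 / ?n r) *\<^sub>R ?g r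
      = G *v ?y r - L (?y r) *\<^sub>R ?y r + \<alpha> r *\<^sub>R (F *v ?y r)" by simp
  qed
qed auto

end

text \<open>The linear lift has solutions for all times, so normalising it gives global existence
  for the quadratic equation, with values in the simplex.\<close>

lemma solution_exists:
  assumes \<alpha>: "\<alpha> \<in> controls a A UNIV" and w: "w \<in> S"
  obtains y where "solution {0..} \<alpha> y" "y 0 = w"
proof -
  obtain W where W: "caratheodory {0..} (\<lambda>v. \<mu> *\<^sub>R v + G *v v) (\<lambda>v. F *v v) \<alpha> W" "W 0 = w"
    using lin.solution_exists[OF \<alpha>] .
  have "solution {0..} \<alpha> (\<lambda>t. (1 / (m \<bullet> W t)) *\<^sub>R W t)"
    by (rule linear_solution_normalized[OF \<alpha> W(1)]) (use W(2) w in \<open>auto simp: simplex_m_def\<close>)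
  then show ?thesis by (rule that) (use W(2) w in \<open>auto simp: simplex_m_def\<close>)
qed

end

section \<open>Comparison of payoffs\<close>

context simplex_control
begin

text \<open>If j were not reachable from i in two steps, then i together with its direct successors
  would form a block \<open>I\<close> that no edge leaves, contradicting irreducibility.\<close>

lemma two_step_irreducible:
  assumes "i \<noteq> j" "N $ i $ j = 0"
  obtains k where "0 < N $ i $ k * N $ k $ j"
proof (rule ccontr)
  assume "\<not> thesis"
  then have no: "N $ i $ k * N $ k $ j = 0" for k
    using that[of k] N_nonneg[of i k] N_nonneg[of k j] by (metis mult_nonneg_nonneg order_less_le)
  define I where "I = {k. k = i \<or> 0 < N $ i $ k}"
  have "(G + a *\<^sub>R F) $ k $ l = 0" if kl: "k \<in> I" "l \<in> - I" for k l
  proof -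
    have "k \<noteq> l" "l \<noteq> i" "N $ i $ l = 0" using kl N_nonneg[of i l] by (auto simp: I_def)
    have "N $ k $ l = 0"
    proof (cases "k = i")
      case False
      then have "0 < N $ i $ k" using kl by (simp add: I_def)
      then have "k \<noteq> j" "N $ k $ j = 0" using assms no[of k] by auto
      \<comment> \<open>Dimension three enters here: i, j and k exhaust the indices, so the only
        possible target outside \<open>I\<close> is j.\<close>
      have "card {i, j, k} = CARD(3)" using False \<open>k \<noteq> j\<close> assms by simp
      then have "{i, j, k} = UNIV" by (intro card_subset_eq) auto
      then have "l = j" using \<open>k \<noteq> l\<close> \<open>l \<noteq> i\<close> by blast
      then show ?thesis using \<open>N $ k $ j = 0\<close> by simp
    qed (use \<open>N $ i $ l = 0\<close> in simp)
    then show ?thesis using \<open>k \<noteq> l\<close> by (simp add: N_def)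
  qed
  moreover have "I \<noteq> {}" "I \<noteq> UNIV" using assms by (auto simp: I_def)
  ultimately show False using irred unfolding reducible_matrix_def by blast
qed

text \<open>The bound is a coordinate of (I + N)^2 v. All entries \<open>E i j\<close> of (I + N)^2
  are positive, by paths of length 0, 1 or 2. Minimising \<open>E i j / m $ j\<close> gives E i j
  \<ge> c m_j, which the normalisation of v turns into the bound c.\<close>

lemma two_step_lower_bound:
  obtains c where "0 < c"
    "\<And>v i. (\<And>j. 0 \<le> v $ j) \<Longrightarrow> m \<bullet> v = 1 \<Longrightarrow> c \<le> v $ i + 2 * (N *v v) $ i + (N *v (N *v v)) $ i"
proof -
  define E where "E i j = (if i = j then 1 else 0) + 2 * N $ i $ j + (\<Sum>k\<in>UNIV. N $ i $ k * N $ k $ j)" for i j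
  have E: "0 < E i j" for i j
  proof -
    have 0: "0 \<le> N $ i $ k * N $ k $ j" for k using N_nonneg by simp
    then have 1: "0 \<le> (\<Sum>k\<in>UNIV. N $ i $ k * N $ k $ j)" by (intro sum_nonneg) auto
    consider "i = j" | "N $ i $ j > 0" | "i \<noteq> j" "N $ i $ j = 0" using N_nonneg[of i j] by fastforce
    then show ?thesis
    proof cases
      case 3
      obtain k where "0 < N $ i $ k * N $ k $ j" using two_step_irreducible[OF 3] .
      then have "0 < (\<Sum>k\<in>UNIV. N $ i $ k * N $ k $ j)" using 0 by (intro sum_pos2[of UNIV k]) auto
      then show ?thesis using 3 by (simp add: E_def)
    qed (use 1 N_nonneg[of i j] in \<open>auto simp: E_def intro: add_pos_nonneg add_nonneg_pos\<close>)
  qed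
  define c where "c = Min (range (\<lambda>(i, j). E i j / m $ j))"
  have cle: "c * m $ j \<le> E i j" for i j
  proof -
    have "c \<le> E i j / m $ j" unfolding c_def by (rule Min_le) (auto intro!: rev_image_eqI[of "(i, j)"])
    then show ?thesis using m by (simp add: field_simps)
  qed
  show ?thesis
  proof
    show "0 < c" unfolding c_def using E m by (subst Min_gr_iff) auto
    fix v :: "real^3" and i assume v: "\<And>j. 0 \<le> v $ j" and mv: "m \<bullet> v = 1"
    have "c = (\<Sum>j\<in>UNIV. (c * m $ j) * v $ j)"
      using mv by (simp add: inner_vec_def sum_distrib_left[symmetric] mult.assoc)
    also have "\<dots> \<le> (\<Sum>j\<in>UNIV. E i j * v $ j)"
      by (intro sum_mono mult_right_mono cle v)
    also have "\<dots> = v $ i + 2 * (N *v v) $ i + (N *v (N *v v)) $ i"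
    proof -
      have "(N *v (N *v v)) $ i = (\<Sum>j\<in>UNIV. (\<Sum>k\<in>UNIV. N $ i $ k * N $ k $ j) * v $ j)"
        by (simp add: matrix_vector_mul_assoc) (simp add: matrix_matrix_mult_def matrix_vector_mult_def)
      moreover have "(if i = j then 1 else 0) * v $ j = (if i = j then v $ j else 0)" for j by simp
      ultimately show ?thesis
        by (simp add: E_def distrib_right sum.distrib sum_distrib_left mult.assoc)
          (simp add: matrix_vector_mult_def sum_distrib_left)
    qed
    finally show "c \<le> v $ i + 2 * (N *v v) $ i + (N *v (N *v v)) $ i" .
  qed
qed

lemma payoff_integral_bound:
  assumes y: "solution {0..} \<alpha> y" and K: "\<And>y. y \<in> S \<Longrightarrow> \<bar>L y\<bar> \<le> K" and st: "0 \<le> s" "s \<le> t"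
  shows "(\<lambda>s. L (y s)) integrable_on {s..t}" "\<bar>integral {s..t} (\<lambda>s. L (y s))\<bar> \<le> K * (t - s)"
proof -
  have "continuous_on {s..t} y"
    by (rule continuous_on_subset[OF solution_continuous_on[OF y]]) (use st in auto)
  then have c: "continuous_on {s..t} (\<lambda>s. L (y s))" by (rule continuous_on_payoff)
  then show "(\<lambda>s. L (y s)) integrable_on {s..t}" by (rule integrable_continuous_interval)
  show "\<bar>integral {s..t} (\<lambda>s. L (y s))\<bar> \<le> K * (t - s)"
    using integral_bound[OF st(2) c, of K] K y st by (auto simp: solution_def)
qed

text \<open>Two solutions driven by the same control: after time 2 the linear flow has made every
  coordinate of the second one comparable to the first, and positivity preserves the
  comparison for ever.\<close>

lemma payoff_comparison:
  obtains C where "0 < C"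
    "\<And>\<alpha> y z t. solution {0..} \<alpha> y \<Longrightarrow> solution {0..} \<alpha> z \<Longrightarrow> 0 \<le> t \<Longrightarrow>
      integral {0..t} (\<lambda>s. L (y s)) - C \<le> integral {0..t} (\<lambda>s. L (z s))"
proof -
  obtain K where K: "0 < K" "\<And>y. y \<in> S \<Longrightarrow> \<bar>L y\<bar> \<le> K" using payoff_bound by blast
  obtain c where c: "0 < c" "\<And>v i. (\<And>j. 0 \<le> v $ j) \<Longrightarrow> m \<bullet> v = 1 \<Longrightarrow>
      c \<le> v $ i + 2 * (N *v v) $ i + (N *v (N *v v)) $ i" using two_step_lower_bound by blast
  \<comment> \<open>Bounds every coordinate of the lift of y at time 2: its mass is at most exp(2
    \<mu> + 2 K), and a coordinate of a point of the simplex is at most the sum of the 1 /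
    m_i.\<close>
  define M where "M = exp (\<mu> * 2 + K * 2) * (\<Sum>i\<in>UNIV. 1 / m $ i)"
  have M: "0 < M" unfolding M_def using m by (intro mult_pos_pos sum_pos) auto
  define \<kappa> where "\<kappa> = c / M"
  have \<kappa>: "0 < \<kappa>" using c M by (simp add: \<kappa>_def)
  show ?thesis
  proof
    \<comment> \<open>The term 4 K settles t \<le> 2, where each integral is at most 2 K in absolute
      value; the logarithm settles larger times.\<close>
    show "0 < 4 * K + \<bar>ln \<kappa>\<bar>" using K by linarith
    fix \<alpha> y z and t :: real
    assume y: "solution {0..} \<alpha> y" and z: "solution {0..} \<alpha> z" and t: "0 \<le> t"
    let ?Y = "\<lambda>t. mass y t *\<^sub>R y t" and ?Z = "\<lambda>t. mass z t *\<^sub>R z t"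
    have \<alpha>: "\<alpha> \<in> controls a A UNIV" and yS: "\<And>t. 0 \<le> t \<Longrightarrow> y t \<in> S" and zS: "\<And>t. 0 \<le> t \<Longrightarrow> z t \<in> S"
      using y z by (auto simp: solution_def)
    have Z0: "0 \<le> ?Z 0 $ i" for i using zS[of 0] mass_pos[of z 0] by (auto simp: simplex_m_def)
    note Z = solution_linear[OF z] and Y = solution_linear[OF y]
    show "integral {0..t} (\<lambda>s. L (y s)) - (4 * K + \<bar>ln \<kappa>\<bar>) \<le> integral {0..t} (\<lambda>s. L (z s))"
    proof (cases "t \<le> 2")
      case True
      have "K * (t - 0) \<le> K * 2" using True K by (intro mult_left_mono) auto
      then show ?thesis
        using payoff_integral_bound(2)[OF y K(2) _ t] payoff_integral_bound(2)[OF z K(2) _ t] by linarith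
    next
      case False
      \<comment> \<open>Two Euler steps of length 1 show that the lift at time 2 dominates (I + N)^2
        applied to its initial value.\<close>
      have Z2: "c \<le> ?Z 2 $ i" for i
      proof -
        have "m \<bullet> ?Z 0 = 1" using zS[of 0] by (simp add: mass_def simplex_m_def)
        then have "c \<le> ?Z 0 $ i + 2 * (N *v ?Z 0) $ i + (N *v (N *v ?Z 0)) $ i"
          by (intro c(2) Z0)
        also have "\<dots> = (?Z 0 + N *v ?Z 0) $ i + (N *v (?Z 0 + N *v ?Z 0)) $ i"
          by (simp add: matrix_vector_right_distrib)
        also have "\<dots> \<le> ?Z 1 $ i + (N *v ?Z 1) $ i"
        proof -
          have "(?Z 0 + N *v ?Z 0) $ j \<le> ?Z 1 $ j" for j
            using linear_solution_growth[OF \<alpha> Z Z0, of 0 1 j] by simp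
          then show ?thesis
            unfolding matrix_vector_mult_def[of N "?Z 0 + _"] matrix_vector_mult_def[of N "?Z 1"]
            using N_nonneg by (auto intro!: add_mono sum_mono mult_left_mono)
        qed
        also have "\<dots> \<le> ?Z 2 $ i"
          using linear_solution_growth[OF \<alpha> Z Z0, of 1 2 i] by simp
        finally show ?thesis .
      qed
      have Y2: "?Y 2 $ i \<le> M" for i
      proof -
        have "mass y 2 \<le> exp (\<mu> * 2 + K * 2)"
          using payoff_integral_bound(2)[OF y K(2), of 0 2] by (simp add: mass_def)
        moreover have "y 2 $ i \<le> (\<Sum>i\<in>UNIV. 1 / m $ i)"
          using m by (intro order_trans[OF simplex_component_le[OF yS]] member_le_sum[of i UNIV "\<lambda>i. 1 / m $ i"])
            (auto simp: less_imp_le)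
        ultimately show ?thesis
          unfolding M_def using yS[of 2] by (auto simp: simplex_m_def intro!: mult_mono)
      qed
      \<comment> \<open>By linearity \<open>X\<close> solves the linear system with the shifted
        control; it starts in the cone because \<kappa> M = c.\<close>
      define X where "X s = ?Z (2 + s) - \<kappa> *\<^sub>R ?Y (2 + s)" for s
      have "0 \<le> X (t - 2) $ i" for i
      proof (rule linear_solution_nonneg[OF controls_shift[OF \<alpha>]])
        show "caratheodory {0..} (\<lambda>v. \<mu> *\<^sub>R v + G *v v) (\<lambda>v. F *v v) (\<lambda>t. \<alpha> (2 + t)) X"
          unfolding X_def
          by (intro lin.caratheodory_lincomb caratheodory_shift[OF Y] caratheodory_shift[OF Z]) auto
        have "\<kappa> * ?Y 2 $ i \<le> \<kappa> * M" for i using \<kappa> Y2 by (intro mult_left_mono) auto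
        moreover have "\<kappa> * M = c" using M by (simp add: \<kappa>_def)
        ultimately have "\<kappa> * ?Y 2 $ i \<le> ?Z 2 $ i" for i using Z2[of i] order_trans by metis
        then show "0 \<le> X 0 $ i" for i unfolding X_def by (simp only: add_0_right vector_minus_component vector_scaleR_component diff_ge_0_iff_ge real_scaleR_def)
      qed (use False in simp)
      \<comment> \<open>Pairing with m turns the vector inequality into one between masses. After
        taking logarithms the terms \<mu> t cancel and only integrated payoffs remain.\<close>
      then have "0 \<le> m \<bullet> X (t - 2)"
        using m by (auto simp: inner_vec_def less_imp_le intro!: sum_nonneg mult_nonneg_nonneg)
      then have "\<kappa> * mass y t \<le> mass z t"
        using yS[OF t] zS[OF t] by (simp add: X_def inner_diff_right simplex_m_def)
      then have "ln (\<kappa> * mass y t) \<le> ln (mass z t)"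
        using \<kappa> mass_pos by (intro ln_mono) (auto intro!: mult_pos_pos)
      then have "ln \<kappa> + integral {0..t} (\<lambda>s. L (y s)) \<le> integral {0..t} (\<lambda>s. L (z s))"
        using \<kappa> mass_pos[of y t] by (simp add: ln_mult mass_def)
      then show ?thesis using K(1) by linarith
    qed
  qed
qed

end

section \<open>Discounted and finite-horizon values\<close>

text \<open>What the limit argument retains of the dynamics: \<open>P y\<close> stands for the
  payoff functions of time available from y. In \<open>P_tail\<close>, y' plays the state reached at
  time T: the tail is available from it, and every continuation from it can be glued on.\<close>

locale payoff_family =
  fixes S :: "'s set" and P :: "'s \<Rightarrow> (real \<Rightarrow> real) set" and K C :: real
  assumes S: "S \<noteq> {}" and C: "0 < C" and K: "0 < K"
    and P_nonempty: "y \<in> S \<Longrightarrow> P y \<noteq> {}"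
    and P_continuous: "y \<in> S \<Longrightarrow> p \<in> P y \<Longrightarrow> continuous_on {0..} p"
    and P_bounded: "y \<in> S \<Longrightarrow> p \<in> P y \<Longrightarrow> 0 \<le> t \<Longrightarrow> \<bar>p t\<bar> \<le> K"
    and P_comparison: "y \<in> S \<Longrightarrow> y' \<in> S \<Longrightarrow> p \<in> P y \<Longrightarrow>
      \<exists>q\<in>P y'. \<forall>t\<ge>0. integral {0..t} p - C \<le> integral {0..t} q"
    and P_tail: "y \<in> S \<Longrightarrow> p \<in> P y \<Longrightarrow> 0 \<le> T \<Longrightarrow>
      \<exists>y'\<in>S. (\<lambda>t. p (T + t)) \<in> P y' \<and> (\<forall>q\<in>P y'. (\<lambda>t. if t < T then p t else q (t - T)) \<in> P y)"

section \<open>Discounted integrals of a single payoff function\<close>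

definition discounted :: "real \<Rightarrow> (real \<Rightarrow> real) \<Rightarrow> real" where
  "discounted \<epsilon> p = integral {0..} (\<lambda>t. exp (- \<epsilon> * t) * p t)"

context
  fixes p :: "real \<Rightarrow> real" and K \<epsilon> :: real
  assumes p: "continuous_on {0..} p" and pK: "\<And>t. 0 \<le> t \<Longrightarrow> \<bar>p t\<bar> \<le> K" and \<epsilon>: "0 < \<epsilon>"
begin

lemma discounted_abs_integrable: "(\<lambda>t. exp (- \<epsilon> * t) * p t) absolutely_integrable_on {0..}"
proof (rule measurable_bounded_by_integrable_imp_absolutely_integrable)
  show "(\<lambda>t. exp (- \<epsilon> * t) * p t) \<in> borel_measurable (lebesgue_on {0..})"
    by (intro continuous_imp_measurable_on_sets_lebesgue continuous_intros p) auto
  show "(\<lambda>t. K * exp (- \<epsilon> * t)) integrable_on {0..}"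
    using integrable_on_exp_minus_to_infinity[OF \<epsilon>] by (rule integrable_on_mult_right)
  show "norm (exp (- \<epsilon> * t) * p t) \<le> K * exp (- \<epsilon> * t)" if "t \<in> {0..}" for t
    using pK[of t] that by (simp add: abs_mult mult.commute)
qed auto

lemma discounted_abs_le: "\<bar>discounted \<epsilon> p\<bar> \<le> K / \<epsilon>"
proof -
  have "norm (integral {0..} (\<lambda>t. exp (- \<epsilon> * t) * p t)) \<le> integral {0..} (\<lambda>t. K * exp (- \<epsilon> * t))"
  proof (rule integral_norm_bound_integral)
    show "(\<lambda>t. exp (- \<epsilon> * t) * p t) integrable_on {0..}"
      using discounted_abs_integrable by (simp add: absolutely_integrable_on_def)
    show "(\<lambda>t. K * exp (- \<epsilon> * t)) integrable_on {0..}"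
      using integrable_on_exp_minus_to_infinity[OF \<epsilon>] by (rule integrable_on_mult_right)
    show "norm (exp (- \<epsilon> * t) * p t) \<le> K * exp (- \<epsilon> * t)" if "t \<in> {0..}" for t
      using pK[of t] that by (simp add: abs_mult mult.commute)
  qed
  also have "\<dots> = K / \<epsilon>"
    using integral_unique[OF has_integral_exp_minus_to_infinity[OF \<epsilon>, of 0]] by simp
  finally show ?thesis by (simp add: discounted_def)
qed

lemma discounted_tendsto:
  "((\<lambda>b. integral {0..b} (\<lambda>t. exp (- \<epsilon> * t) * p t)) \<longlongrightarrow> discounted \<epsilon> p) at_top"
proof -
  let ?f = "\<lambda>t. exp (- \<epsilon> * t) * p t"
  have "((\<lambda>b. set_lebesgue_integral lebesgue {0..b} ?f) \<longlongrightarrow> set_lebesgue_integral lebesgue {0..} ?f) at_top"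
    by (rule tendsto_set_lebesgue_integral_at_top[OF _ discounted_abs_integrable]) auto
  moreover have "set_lebesgue_integral lebesgue {0..b} ?f = integral {0..b} ?f" for b
    by (intro set_lebesgue_integral_eq_integral(2) set_integrable_subset[OF discounted_abs_integrable]) auto
  moreover have "set_lebesgue_integral lebesgue {0..} ?f = integral {0..} ?f"
    by (rule set_lebesgue_integral_eq_integral(2)[OF discounted_abs_integrable])
  ultimately show ?thesis by (simp add: discounted_def)
qed

lemma discounted_integrable_Icc: "0 \<le> s \<Longrightarrow> (\<lambda>t. exp (- \<epsilon> * t) * p t) integrable_on {s..b}"
  by (intro integrable_continuous_interval continuous_intros continuous_on_subset[OF p]) auto

lemma payoff_integrable_Icc: "0 \<le> s \<Longrightarrow> p integrable_on {s..b}"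
  by (intro integrable_continuous_interval continuous_intros continuous_on_subset[OF p]) auto

text \<open>On [0, T] the weight differs from 1 by at most \<epsilon> T; a second factor T comes
  from the length of the interval.\<close>

lemma discounted_initial_segment:
  assumes T: "0 \<le> T"
  shows "\<bar>integral {0..T} (\<lambda>t. exp (- \<epsilon> * t) * p t) - integral {0..T} p\<bar> \<le> K * \<epsilon> * T\<^sup>2"
proof -
  have K0: "0 \<le> K" using pK[of 0] by linarith
  have "((\<lambda>t. exp (- \<epsilon> * t) * p t - p t) has_integral
      integral {0..T} (\<lambda>t. exp (- \<epsilon> * t) * p t) - integral {0..T} p) {0..T}"
    by (intro has_integral_diff integrable_integral discounted_integrable_Icc payoff_integrable_Icc) auto
  moreover have "norm (exp (- \<epsilon> * t) * p t - p t) \<le> K * \<epsilon> * T" if t: "t \<in> {0..T}" for t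
  proof -
    have "exp (- \<epsilon> * t) * p t - p t = - ((1 - exp (- \<epsilon> * t)) * p t)" by (simp add: algebra_simps)
    moreover have "0 \<le> 1 - exp (- \<epsilon> * t)" "1 - exp (- \<epsilon> * t) \<le> \<epsilon> * T"
    proof -
      show "0 \<le> 1 - exp (- \<epsilon> * t)" using t \<epsilon> by simp
      have "1 + (- \<epsilon> * t) \<le> exp (- \<epsilon> * t)" by (rule exp_ge_add_one_self)
      moreover have "\<epsilon> * t \<le> \<epsilon> * T" using t \<epsilon> by simp
      ultimately show "1 - exp (- \<epsilon> * t) \<le> \<epsilon> * T" by linarith
    qed
    then have "\<bar>1 - exp (- \<epsilon> * t)\<bar> * \<bar>p t\<bar> \<le> (\<epsilon> * T) * K"
      using pK[of t] t T \<epsilon> K0 by (intro mult_mono) auto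
    ultimately show ?thesis by (simp add: abs_mult mult_ac)
  qed
  ultimately have "norm (integral {0..T} (\<lambda>t. exp (- \<epsilon> * t) * p t) - integral {0..T} p) \<le> K * \<epsilon> * T * Henstock_Kurzweil_Integration.content {0..T}"
    using T \<epsilon> K0 by (intro has_integral_bound_real[of _ "{}"]) auto
  then show ?thesis using T by (simp add: power2_eq_square mult_ac)
qed

end

lemma discounted_split:
  assumes p: "continuous_on {0..} p" "\<And>t. 0 \<le> t \<Longrightarrow> \<bar>p t\<bar> \<le> K" and \<epsilon>: "0 < \<epsilon>" and T: "0 \<le> T"
  shows "discounted \<epsilon> p = integral {0..T} (\<lambda>t. exp (- \<epsilon> * t) * p t) + exp (- \<epsilon> * T) * discounted \<epsilon> (\<lambda>t. p (T + t))"
proof -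
  let ?f = "\<lambda>t. exp (- \<epsilon> * t) * p t" and ?q = "\<lambda>t. p (T + t)"
  have q: "continuous_on {0..} ?q" "\<And>t. 0 \<le> t \<Longrightarrow> \<bar>?q t\<bar> \<le> K"
    using p(2) T by (auto intro!: continuous_on_compose2[OF p(1)] continuous_intros)
  have "((\<lambda>b. integral {0..T + b} ?f) \<longlongrightarrow> discounted \<epsilon> p) at_top"
    by (rule filterlim_compose[OF discounted_tendsto[OF p \<epsilon>]])
      (auto intro: filterlim_tendsto_add_at_top tendsto_const filterlim_ident)
  moreover have "eventually (\<lambda>b. integral {0..T + b} ?f =
      integral {0..T} ?f + exp (- \<epsilon> * T) * integral {0..b} (\<lambda>t. exp (- \<epsilon> * t) * ?q t)) at_top"
    using eventually_ge_at_top[of 0]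
  proof eventually_elim
    case (elim b)
    have "integral {0..T + b} ?f = integral {0..T} ?f + integral {T..T + b} ?f"
      using elim T by (intro Henstock_Kurzweil_Integration.integral_combine[symmetric]
          discounted_integrable_Icc[OF p \<epsilon>]) auto
    also have "integral {T..T + b} ?f = integral {0..b} (\<lambda>t. ?f (t + T))"
      using integral_shift_real_ivl[of T T "T + b" ?f] by simp
    also have "(\<lambda>t. ?f (t + T)) = (\<lambda>t. exp (- \<epsilon> * T) * (exp (- \<epsilon> * t) * ?q t))"
      by (auto simp: distrib_left exp_add[symmetric] mult.assoc[symmetric] add_ac)
    also have "integral {0..b} \<dots> = exp (- \<epsilon> * T) * integral {0..b} (\<lambda>t. exp (- \<epsilon> * t) * ?q t)"
      by (rule integral_mult_right)
    finally show ?case .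
  qed
  ultimately have "((\<lambda>b. integral {0..T} ?f + exp (- \<epsilon> * T) * integral {0..b} (\<lambda>t. exp (- \<epsilon> * t) * ?q t))
      \<longlongrightarrow> discounted \<epsilon> p) at_top"
    by (rule Lim_transform_eventually)
  moreover have "((\<lambda>b. integral {0..T} ?f + exp (- \<epsilon> * T) * integral {0..b} (\<lambda>t. exp (- \<epsilon> * t) * ?q t))
      \<longlongrightarrow> integral {0..T} ?f + exp (- \<epsilon> * T) * discounted \<epsilon> ?q) at_top"
    by (intro tendsto_intros discounted_tendsto[OF q \<epsilon>])
  ultimately show ?thesis using tendsto_unique trivial_limit_at_top_linorder by blast
qed

text \<open>The weight decreases from 1, so by the second mean value theorem a discounted integral
  is a convex combination of undiscounted running integrals. Hence the constant C carries over
  unchanged for every \<epsilon>.\<close>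

lemma discounted_comparison:
  assumes p: "continuous_on {0..} p" "\<And>t. 0 \<le> t \<Longrightarrow> \<bar>p t\<bar> \<le> K"
    and q: "continuous_on {0..} q" "\<And>t. 0 \<le> t \<Longrightarrow> \<bar>q t\<bar> \<le> K" and \<epsilon>: "0 < \<epsilon>" 
    and pq: "\<And>t. 0 \<le> t \<Longrightarrow> integral {0..t} p - C \<le> integral {0..t} q"
  shows "discounted \<epsilon> p - C \<le> discounted \<epsilon> q"
proof -
  have fin: "- C \<le> integral {0..b} (\<lambda>t. exp (- \<epsilon> * t) * q t) - integral {0..b} (\<lambda>t. exp (- \<epsilon> * t) * p t)"
    if b: "0 \<le> b" for b
  proof -
    let ?f = "\<lambda>t. q t - p t"
    have f: "?f integrable_on {s..b}" if "0 \<le> s" for s b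
      using that by (intro integrable_diff payoff_integrable_Icc[OF p \<epsilon>] payoff_integrable_Icc[OF q \<epsilon>]) auto
    have I: "- C \<le> integral {0..t} ?f" if "0 \<le> t" for t
      using pq[OF that] by (subst Henstock_Kurzweil_Integration.integral_diff)
        (auto intro: payoff_integrable_Icc[OF p \<epsilon>] payoff_integrable_Icc[OF q \<epsilon>])
    \<comment> \<open>The weight is negated because the mean value theorem is stated for increasing
      weights.\<close>
    have "- exp (- \<epsilon> * x) \<le> - exp (- \<epsilon> * y)" if "0 \<le> x" "x \<le> y" "y \<le> b" for x y
      using that \<epsilon> by simp
    from second_mean_value_theorem[where g="\<lambda>t. - exp (- \<epsilon> * t)", OF f[of 0 b] b this]
    obtain c where c: "c \<in> {0..b}" and eq: "integral {0..b} (\<lambda>t. - exp (- \<epsilon> * t) * ?f t)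
        = - exp (- \<epsilon> * 0) * integral {0..c} ?f + - exp (- \<epsilon> * b) * integral {c..b} ?f"
      by blast
    have split: "integral {0..c} ?f + integral {c..b} ?f = integral {0..b} ?f"
      using c f by (intro Henstock_Kurzweil_Integration.integral_combine) auto
    have "integral {0..b} (\<lambda>t. exp (- \<epsilon> * t) * ?f t) = - integral {0..b} (\<lambda>t. - exp (- \<epsilon> * t) * ?f t)"
      by simp
    \<comment> \<open>The coefficients are nonnegative and sum to 1, so the bound -C on both running
      integrals is inherited.\<close>
    also have "\<dots> = (1 - exp (- \<epsilon> * b)) * integral {0..c} ?f + exp (- \<epsilon> * b) * integral {0..b} ?f"
      unfolding eq split[symmetric] by (simp add: algebra_simps)
    also have "\<dots> \<ge> (1 - exp (- \<epsilon> * b)) * (- C) + exp (- \<epsilon> * b) * (- C)"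
      using \<epsilon> b c by (intro add_mono mult_left_mono I) auto
    finally have "- C \<le> integral {0..b} (\<lambda>t. exp (- \<epsilon> * t) * ?f t)" by (simp add: algebra_simps)
    also have "\<dots> = integral {0..b} (\<lambda>t. exp (- \<epsilon> * t) * q t - exp (- \<epsilon> * t) * p t)"
      by (simp add: algebra_simps)
    also have "\<dots> = integral {0..b} (\<lambda>t. exp (- \<epsilon> * t) * q t) - integral {0..b} (\<lambda>t. exp (- \<epsilon> * t) * p t)"
      by (intro Henstock_Kurzweil_Integration.integral_diff discounted_integrable_Icc[OF p \<epsilon>] discounted_integrable_Icc[OF q \<epsilon>]) auto
    finally show ?thesis .
  qed
  have "- C \<le> discounted \<epsilon> q - discounted \<epsilon> p"
  proof (rule tendsto_lowerbound)
    show "((\<lambda>b. integral {0..b} (\<lambda>t. exp (- \<epsilon> * t) * q t) - integral {0..b} (\<lambda>t. exp (- \<epsilon> * t) * p t))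
        \<longlongrightarrow> discounted \<epsilon> q - discounted \<epsilon> p) at_top"
      by (intro tendsto_intros discounted_tendsto[OF p \<epsilon>] discounted_tendsto[OF q \<epsilon>])
    show "\<forall>\<^sub>F b in at_top. - C \<le> integral {0..b} (\<lambda>t. exp (- \<epsilon> * t) * q t) - integral {0..b} (\<lambda>t. exp (- \<epsilon> * t) * p t)"
      using eventually_ge_at_top[of 0] by eventually_elim (rule fin)
  qed simp
  then show ?thesis by simp
qed

section \<open>Dynamic programming and the common limit of the two values\<close>

context payoff_family
begin

definition horizon_value :: "real \<Rightarrow> 's \<Rightarrow> real" where
  "horizon_value T y = (SUP p\<in>P y. integral {0..T} p)"

definition disc_value :: "real \<Rightarrow> 's \<Rightarrow> real" where
  "disc_value \<epsilon> y = (SUP p\<in>P y. discounted \<epsilon> p)"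

lemma payoff_integral_le:
  assumes "y \<in> S" "p \<in> P y" "0 \<le> T"
  shows "\<bar>integral {0..T} p\<bar> \<le> K * T"
proof -
  have "continuous_on {0..T} p" by (rule continuous_on_subset[OF P_continuous[OF assms(1,2)]]) auto
  from integral_bound[OF assms(3) this, of K] show ?thesis
    using P_bounded[OF assms(1,2)] by auto
qed

lemma bdd_above_horizon: "y \<in> S \<Longrightarrow> 0 \<le> T \<Longrightarrow> bdd_above ((\<lambda>p. integral {0..T} p) ` P y)"
  using payoff_integral_le by (intro bdd_aboveI2[of _ _ "K * T"]) (auto simp: abs_le_iff)

lemma payoff_discounted_le:
  assumes "y \<in> S" "p \<in> P y" "0 < \<epsilon>"
  shows "\<bar>discounted \<epsilon> p\<bar> \<le> K / \<epsilon>"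
  by (rule discounted_abs_le[OF P_continuous[OF assms(1,2)] P_bounded[OF assms(1,2)] assms(3)])

lemma bdd_above_disc: "y \<in> S \<Longrightarrow> 0 < \<epsilon> \<Longrightarrow> bdd_above (discounted \<epsilon> ` P y)"
  using payoff_discounted_le
  by (intro bdd_aboveI2[of _ _ "K / \<epsilon>"]) (auto simp: abs_le_iff)

text \<open>The oscillation of the discounted value over S is at most C for every \<epsilon>; after
  multiplication by \<epsilon> it vanishes in the limit, which makes the limit constant.\<close>

lemma disc_value_comparison:
  assumes "y \<in> S" "y' \<in> S" "0 < \<epsilon>"
  shows "disc_value \<epsilon> y - C \<le> disc_value \<epsilon> y'"
proof -
  have "disc_value \<epsilon> y \<le> disc_value \<epsilon> y' + C"
    unfolding disc_value_def[of \<epsilon> y]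
  proof (rule cSUP_least[OF P_nonempty[OF assms(1)]])
    fix p assume p: "p \<in> P y"
    obtain q where q: "q \<in> P y'" "\<And>t. 0 \<le> t \<Longrightarrow> integral {0..t} p - C \<le> integral {0..t} q"
      using P_comparison[OF assms(1,2) p] by blast
    have "discounted \<epsilon> p - C \<le> discounted \<epsilon> q"
      using assms p q
      by (intro discounted_comparison[of p K q]) (auto intro: P_continuous P_bounded)
    also have "\<dots> \<le> disc_value \<epsilon> y'"
      unfolding disc_value_def by (rule cSUP_upper[OF q(1) bdd_above_disc[OF assms(2,3)]])
    finally show "discounted \<epsilon> p \<le> disc_value \<epsilon> y' + C" by simp
  qed
  then show ?thesis by simp
qed

lemma disc_value_abs_le:
  assumes "y \<in> S" "0 < \<epsilon>"
  shows "\<bar>\<epsilon> * disc_value \<epsilon> y\<bar> \<le> K"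
proof -
  have b: "\<bar>discounted \<epsilon> p\<bar> \<le> K / \<epsilon>" if "p \<in> P y" for p
    by (rule payoff_discounted_le[OF assms(1) that assms(2)])
  obtain p where p: "p \<in> P y" using P_nonempty[OF assms(1)] by blast
  have "disc_value \<epsilon> y \<le> K / \<epsilon>"
    unfolding disc_value_def using b by (intro cSUP_least[OF P_nonempty[OF assms(1)]]) (auto simp: abs_le_iff)
  moreover have "- (K / \<epsilon>) \<le> disc_value \<epsilon> y"
    using cSUP_upper[OF p bdd_above_disc[OF assms]] b[OF p] by (simp add: disc_value_def)
  ultimately have "\<bar>disc_value \<epsilon> y\<bar> \<le> K / \<epsilon>" by linarith
  then show ?thesis using assms(2) by (simp add: abs_mult field_simps)
qed

text \<open>Dynamic programming on \<open>[0, T]\<close>; the discounted value of the state reached at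
  time \<open>T\<close> is replaced by that of the initial state at the cost of \<^term>\<open>C\<close>.\<close>

lemma dynamic_programming:
  assumes y: "y \<in> S" and \<epsilon>: "0 < \<epsilon>" and T: "0 < T"
  shows "\<bar>(1 - exp (- \<epsilon> * T)) * disc_value \<epsilon> y - horizon_value T y\<bar> \<le> C + K * \<epsilon> * T\<^sup>2"
proof -
  let ?e = "exp (- \<epsilon> * T)"
  have T0: "0 \<le> T" and e: "0 < ?e" "?e \<le> 1" using T \<epsilon> by auto
  have eC: "?e * C \<le> C" using e C by (simp add: mult_left_le_one_le)
  \<comment> \<open>Upper half: the tail of any p competes in the discounted problem started from
    the state reached at time T.\<close>
  have "disc_value \<epsilon> y \<le> horizon_value T y + K * \<epsilon> * T\<^sup>2 + (?e * disc_value \<epsilon> y + C)"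
  proof -
    have "discounted \<epsilon> p \<le> horizon_value T y + K * \<epsilon> * T\<^sup>2 + (?e * disc_value \<epsilon> y + C)" if p: "p \<in> P y" for p
    proof -
      obtain y' where y': "y' \<in> S" "(\<lambda>t. p (T + t)) \<in> P y'" using P_tail[OF y p T0] by blast
      note pp = P_continuous[OF y p] P_bounded[OF y p]
      have "?e * discounted \<epsilon> (\<lambda>t. p (T + t)) \<le> ?e * (disc_value \<epsilon> y + C)"
      proof (intro mult_left_mono)
        have "discounted \<epsilon> (\<lambda>t. p (T + t)) \<le> disc_value \<epsilon> y'"
          unfolding disc_value_def by (rule cSUP_upper[OF y'(2) bdd_above_disc[OF y'(1) \<epsilon>]])
        also have "\<dots> \<le> disc_value \<epsilon> y + C" using disc_value_comparison[OF y'(1) y \<epsilon>] by simp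
        finally show "discounted \<epsilon> (\<lambda>t. p (T + t)) \<le> disc_value \<epsilon> y + C" .
      qed (use e in simp)
      also have "\<dots> \<le> ?e * disc_value \<epsilon> y + C" using eC by (simp add: distrib_left)
      finally have "?e * discounted \<epsilon> (\<lambda>t. p (T + t)) \<le> ?e * disc_value \<epsilon> y + C" .
      moreover have "integral {0..T} (\<lambda>t. exp (- \<epsilon> * t) * p t) \<le> integral {0..T} p + K * \<epsilon> * T\<^sup>2"
        using discounted_initial_segment[OF pp \<epsilon> T0] by linarith
      moreover have "integral {0..T} p \<le> horizon_value T y"
        unfolding horizon_value_def by (rule cSUP_upper[OF p bdd_above_horizon[OF y T0]])
      ultimately show ?thesis using discounted_split[OF pp \<epsilon> T0] by linarith
    qed
    then show ?thesis
      unfolding disc_value_def[of \<epsilon> y] by (intro cSUP_least[OF P_nonempty[OF y]])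
  qed
  \<comment> \<open>Lower half: any p followed until T and then continued by an arbitrary q from the
    state reached competes in the discounted problem from y.\<close>
  moreover have "horizon_value T y \<le> disc_value \<epsilon> y + K * \<epsilon> * T\<^sup>2 - (?e * disc_value \<epsilon> y - C)"
    unfolding horizon_value_def
  proof (rule cSUP_least[OF P_nonempty[OF y]])
    fix p assume p: "p \<in> P y"
    note pp = P_continuous[OF y p] P_bounded[OF y p]
    obtain y' where y': "y' \<in> S" and cat: "\<And>q. q \<in> P y' \<Longrightarrow> (\<lambda>t. if t < T then p t else q (t - T)) \<in> P y"
      using P_tail[OF y p T0] by blast
    \<comment> \<open>Dividing by the positive weight isolates the supremum over q, so that it can
      be bounded term by term.\<close>
    have "disc_value \<epsilon> y' \<le> (disc_value \<epsilon> y + K * \<epsilon> * T\<^sup>2 - integral {0..T} p) / ?e"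
      unfolding disc_value_def[of \<epsilon> y']
    proof (rule cSUP_least[OF P_nonempty[OF y']])
      fix q assume q: "q \<in> P y'"
      let ?r = "\<lambda>t. if t < T then p t else q (t - T)"
      have "discounted \<epsilon> ?r \<le> disc_value \<epsilon> y"
        unfolding disc_value_def by (rule cSUP_upper[OF cat[OF q] bdd_above_disc[OF y \<epsilon>]])
      moreover have "discounted \<epsilon> ?r = integral {0..T} (\<lambda>t. exp (- \<epsilon> * t) * p t) + ?e * discounted \<epsilon> q"
      proof -
        have "discounted \<epsilon> ?r = integral {0..T} (\<lambda>t. exp (- \<epsilon> * t) * ?r t) + ?e * discounted \<epsilon> (\<lambda>t. ?r (T + t))"
          by (rule discounted_split[OF P_continuous[OF y cat[OF q]] P_bounded[OF y cat[OF q]] \<epsilon> T0])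
        moreover have "integral {0..T} (\<lambda>t. exp (- \<epsilon> * t) * ?r t) = integral {0..T} (\<lambda>t. exp (- \<epsilon> * t) * p t)"
          by (rule integral_spike[of "{T}"]) auto
        moreover have "discounted \<epsilon> (\<lambda>t. ?r (T + t)) = discounted \<epsilon> q"
          unfolding discounted_def by (rule integral_cong) auto
        ultimately show ?thesis by (simp only:)
      qed
      moreover have "integral {0..T} p - K * \<epsilon> * T\<^sup>2 \<le> integral {0..T} (\<lambda>t. exp (- \<epsilon> * t) * p t)"
        using discounted_initial_segment[OF pp \<epsilon> T0] by linarith
      ultimately have "?e * discounted \<epsilon> q \<le> disc_value \<epsilon> y + K * \<epsilon> * T\<^sup>2 - integral {0..T} p" by linarith
      then show "discounted \<epsilon> q \<le> (disc_value \<epsilon> y + K * \<epsilon> * T\<^sup>2 - integral {0..T} p) / ?e"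
        using e by (simp add: pos_le_divide_eq mult.commute)
    qed
    then have "?e * disc_value \<epsilon> y' \<le> disc_value \<epsilon> y + K * \<epsilon> * T\<^sup>2 - integral {0..T} p"
      using e by (simp add: pos_le_divide_eq mult.commute)
    moreover have "?e * (disc_value \<epsilon> y - C) \<le> ?e * disc_value \<epsilon> y'"
      using e disc_value_comparison[OF y y' \<epsilon>] by (intro mult_left_mono) auto
    then have "?e * disc_value \<epsilon> y - C \<le> ?e * disc_value \<epsilon> y'"
      using eC by (simp add: right_diff_distrib)
    ultimately show "integral {0..T} p \<le> disc_value \<epsilon> y + K * \<epsilon> * T\<^sup>2 - (?e * disc_value \<epsilon> y - C)"
      by linarith
  qed
  moreover have "(1 - ?e) * disc_value \<epsilon> y = disc_value \<epsilon> y - ?e * disc_value \<epsilon> y"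
    by (simp add: left_diff_distrib)
  ultimately show ?thesis unfolding abs_le_iff by linarith
qed

text \<open>Divide the dynamic programming estimate by T. The factor (1 - exp(-\<epsilon> T)) / T
  differs from \<epsilon> by at most \<epsilon> (\<epsilon> T), and |\<epsilon> u| \<le> K turns
  this into an error K \<epsilon> T. The term C \<epsilon> pays for changing the initial
  point.\<close>

lemma horizon_disc_close:
  assumes y: "y \<in> S" "y' \<in> S" and \<epsilon>: "0 < \<epsilon>" and T: "0 < T"
  shows "\<bar>horizon_value T y / T - \<epsilon> * disc_value \<epsilon> y'\<bar> \<le> C / T + 2 * K * (\<epsilon> * T) + C * \<epsilon>"
proof -
  let ?x = "\<epsilon> * T" and ?v = "disc_value \<epsilon> y"
  have x: "0 < ?x" using \<epsilon> T by simp
  have "\<bar>(1 - exp (- ?x)) * ?v - horizon_value T y\<bar> / T \<le> (C + K * \<epsilon> * T\<^sup>2) / T"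
    using dynamic_programming[OF y(1) \<epsilon> T] T by (intro divide_right_mono) auto
  then have 1: "\<bar>(1 - exp (- ?x)) * ?v / T - horizon_value T y / T\<bar> \<le> C / T + K * ?x"
    using T by (simp add: diff_divide_distrib[symmetric] abs_divide add_divide_distrib power2_eq_square mult_ac)
  have exp_bounds: "0 \<le> exp (- ?x) - 1 + ?x" "exp (- ?x) - 1 + ?x \<le> ?x * ?x"
  proof -
    show "0 \<le> exp (- ?x) - 1 + ?x" using exp_ge_add_one_self[of "- ?x"] by linarith
    have "exp (- ?x) \<le> 1 / (1 + ?x)"
      using exp_ge_add_one_self[of ?x] x by (simp add: exp_minus field_simps)
    also have "\<dots> \<le> 1 - ?x + ?x * ?x"
    proof -
      \<comment> \<open>With x = \<epsilon> T, this identity gives 1 / (1 + x) \<le> 1 - x + x^2,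
        hence a quadratic error for exp(-x).\<close>
      have "(1 - ?x + ?x * ?x) * (1 + ?x) = 1 + ?x ^ 3" by (simp add: algebra_simps power3_eq_cube)
      moreover have "0 < ?x ^ 3" using x by (rule zero_less_power)
      ultimately have "1 \<le> (1 - ?x + ?x * ?x) * (1 + ?x)" by linarith
      then show ?thesis using x by (simp add: pos_divide_le_eq)
    qed
    finally show "exp (- ?x) - 1 + ?x \<le> ?x * ?x" by linarith
  qed
  have "\<epsilon> * ?v - (1 - exp (- ?x)) * ?v / T = (exp (- ?x) - 1 + ?x) * (\<epsilon> * ?v) / ?x"
    using \<epsilon> T by (simp add: field_simps)
  also have "\<bar>\<dots>\<bar> = (exp (- ?x) - 1 + ?x) * \<bar>\<epsilon> * ?v\<bar> / ?x"
    unfolding abs_divide abs_mult[of "exp (- ?x) - 1 + ?x"] abs_of_nonneg[OF exp_bounds(1)] abs_of_pos[OF x] ..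
  also have "\<dots> \<le> (?x * ?x) * K / ?x"
    using exp_bounds x disc_value_abs_le[OF y(1) \<epsilon>] K by (intro divide_right_mono mult_mono) auto
  also have "\<dots> = K * ?x" using x by simp
  finally have 2: "\<bar>\<epsilon> * ?v - (1 - exp (- ?x)) * ?v / T\<bar> \<le> K * ?x" .
  have "\<bar>?v - disc_value \<epsilon> y'\<bar> \<le> C"
    using disc_value_comparison[OF y \<epsilon>] disc_value_comparison[OF y(2,1) \<epsilon>] by linarith
  then have "\<epsilon> * \<bar>?v - disc_value \<epsilon> y'\<bar> \<le> \<epsilon> * C" using \<epsilon> by (intro mult_left_mono) auto
  moreover have "\<epsilon> * \<bar>?v - disc_value \<epsilon> y'\<bar> = \<bar>\<epsilon> * ?v - \<epsilon> * disc_value \<epsilon> y'\<bar>"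
    using \<epsilon> by (simp add: abs_mult right_diff_distrib[symmetric])
  ultimately show ?thesis using 1 2 by (simp add: mult.commute[of C] abs_le_iff)
qed

text \<open>Both averages are compared with the same \<epsilon> u(y); letting \<epsilon> tend to 0
  with T and T' fixed removes every error except C / T and C / T'.\<close>

lemma horizon_value_close:
  assumes "y \<in> S" "y' \<in> S" "0 < T" "0 < T'"
  shows "\<bar>horizon_value T y / T - horizon_value T' y' / T'\<bar> \<le> C / T + C / T'"
proof (rule tendsto_lowerbound)
  let ?b = "\<lambda>\<epsilon>. (C / T + 2 * K * (\<epsilon> * T) + C * \<epsilon>) + (C / T' + 2 * K * (\<epsilon> * T') + C * \<epsilon>)"
  show "(?b \<longlongrightarrow> C / T + C / T') (at_right 0)"
    by (rule tendsto_eq_intros refl | simp)+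
  show "\<forall>\<^sub>F \<epsilon> in at_right 0. \<bar>horizon_value T y / T - horizon_value T' y' / T'\<bar> \<le> ?b \<epsilon>"
    using eventually_at_right_less
  proof eventually_elim
    case (elim \<epsilon>)
    show ?case
      using horizon_disc_close[OF assms(1,1) elim assms(3)] horizon_disc_close[OF assms(2,1) elim assms(4)]
      by linarith
  qed
qed simp

theorem values_converge:
  obtains l where "uniform_limit S (\<lambda>\<epsilon> y. \<epsilon> * disc_value \<epsilon> y) (\<lambda>_. l) (at_right 0)"
    and "uniform_limit S (\<lambda>T y. horizon_value T y / T) (\<lambda>_. l) at_top"
proof -
  obtain y0 where y0: "y0 \<in> S" using S by blast
  let ?v = "\<lambda>T. horizon_value T y0 / T"
  have Cn: "(\<lambda>n. C / real (Suc n)) \<longlonglongrightarrow> 0"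
    by (intro tendsto_divide_0[OF tendsto_const] filterlim_at_top_imp_at_infinity
        filterlim_compose[OF filterlim_real_sequentially filterlim_Suc])
  \<comment> \<open>A sequence of horizons suffices to find the candidate limit; \<open>Suc\<close>
    keeps the horizon positive.\<close>
  have "Cauchy (\<lambda>n. ?v (real (Suc n)))"
  proof (rule metric_CauchyI)
    fix e :: real assume "0 < e"
    then have "eventually (\<lambda>n. C / real (Suc n) < e / 2) sequentially"
      using order_tendstoD(2)[OF Cn, of "e / 2"] by simp
    then obtain M where M: "\<And>n. M \<le> n \<Longrightarrow> C / real (Suc n) < e / 2" by (auto simp: eventually_sequentially)
    show "\<exists>M. \<forall>i\<ge>M. \<forall>n\<ge>M. dist (?v (real (Suc i))) (?v (real (Suc n))) < e"
    proof (intro exI[of _ M] allI impI)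
      fix i n assume "M \<le> i" "M \<le> n"
      then show "dist (?v (real (Suc i))) (?v (real (Suc n))) < e"
        using M[of i] M[of n] horizon_value_close[OF y0 y0, of "real (Suc i)" "real (Suc n)"]
        unfolding dist_real_def by linarith
    qed
  qed
  then obtain l where l: "(\<lambda>n. ?v (real (Suc n))) \<longlonglongrightarrow> l"
    using Cauchy_convergent convergent_def by metis
  \<comment> \<open>Sending only the second horizon to infinity yields a rate C / T independent of
    y, hence uniformity.\<close>
  have vl: "\<bar>horizon_value T y / T - l\<bar> \<le> C / T" if "y \<in> S" "0 < T" for y T
  proof (rule LIMSEQ_le)
    show "(\<lambda>n. \<bar>horizon_value T y / T - ?v (real (Suc n))\<bar>) \<longlonglongrightarrow> \<bar>horizon_value T y / T - l\<bar>"
      by (intro tendsto_intros l)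
    show "(\<lambda>n. C / T + C / real (Suc n)) \<longlonglongrightarrow> C / T"
      using tendsto_add[OF tendsto_const Cn, of "C / T"] by simp
    show "\<exists>N. \<forall>n\<ge>N. \<bar>horizon_value T y / T - ?v (real (Suc n))\<bar> \<le> C / T + C / real (Suc n)"
      using horizon_value_close[OF that(1) y0 that(2)] by auto
  qed
  have wl: "\<bar>\<epsilon> * disc_value \<epsilon> y - l\<bar> \<le> (2 * C + 2 * K) * sqrt \<epsilon> + C * \<epsilon>" if y: "y \<in> S" and \<epsilon>: "0 < \<epsilon>" for y \<epsilon>
  proof -
    \<comment> \<open>This horizon balances the errors C / T and \<epsilon> T, both of order
      \<open>sqrt \<epsilon>\<close>.\<close>
    define T where "T = 1 / sqrt \<epsilon>"
    have T: "0 < T" "C / T = C * sqrt \<epsilon>" "\<epsilon> * T = sqrt \<epsilon>"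
      using \<epsilon> by (auto simp: T_def real_div_sqrt)
    have "(2 * C + 2 * K) * sqrt \<epsilon> = C * sqrt \<epsilon> + C * sqrt \<epsilon> + 2 * K * sqrt \<epsilon>" by (simp add: algebra_simps)
    then show ?thesis
      using horizon_disc_close[OF y y \<epsilon> T(1)] vl[OF y T(1)] unfolding T(2,3) by linarith
  qed
  show ?thesis
  proof
    show "uniform_limit S (\<lambda>\<epsilon> y. \<epsilon> * disc_value \<epsilon> y) (\<lambda>_. l) (at_right 0)"
    proof (rule uniform_limitI)
      fix e :: real assume e: "0 < e"
      have "((\<lambda>\<epsilon>. (2 * C + 2 * K) * sqrt \<epsilon> + C * \<epsilon>) \<longlongrightarrow> (2 * C + 2 * K) * sqrt 0 + C * 0) (at_right 0)"
        by (intro tendsto_intros)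
      then have "\<forall>\<^sub>F \<epsilon> in at_right 0. (2 * C + 2 * K) * sqrt \<epsilon> + C * \<epsilon> < e"
        using e by (intro order_tendstoD) auto
      moreover have "\<forall>\<^sub>F \<epsilon> in at_right (0::real). 0 < \<epsilon>" by (rule eventually_at_right_less)
      ultimately show "\<forall>\<^sub>F \<epsilon> in at_right 0. \<forall>y\<in>S. dist (\<epsilon> * disc_value \<epsilon> y) l < e"
        by eventually_elim (use wl in \<open>force simp: dist_real_def\<close>)
    qed
    show "uniform_limit S (\<lambda>T y. horizon_value T y / T) (\<lambda>_. l) at_top"
    proof (rule uniform_limitI)
      fix e :: real assume e: "0 < e"
      have "((\<lambda>T. C / T) \<longlongrightarrow> 0) at_top"
        by (intro tendsto_divide_0[OF tendsto_const] filterlim_at_top_imp_at_infinity filterlim_ident)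
      then have "\<forall>\<^sub>F T in at_top. C / T < e" using e by (intro order_tendstoD) auto
      moreover have "\<forall>\<^sub>F T in at_top. (0::real) < T" by (rule eventually_gt_at_top)
      ultimately show "\<forall>\<^sub>F T in at_top. \<forall>y\<in>S. dist (horizon_value T y / T) l < e"
        by eventually_elim (use vl in \<open>force simp: dist_real_def\<close>)
    qed
  qed
qed

end

section \<open>The optimal control problem\<close>

text \<open>Outside \<open>J\<close> the admissible constant a serves as default value.\<close>

lemma controls_extend:
  assumes \<alpha>: "\<alpha> \<in> controls a A J" and J: "J \<in> sets lebesgue" and "a \<le> A"
  shows "(\<lambda>t. if t \<in> J then \<alpha> t else a) \<in> controls a A UNIV"
proof -
  have "\<alpha> \<in> measurable (restrict_space lebesgue {t. t \<in> J}) borel" using \<alpha> by (simp add: controls_def)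
  then have "(\<lambda>t. if t \<in> J then \<alpha> t else a) \<in> borel_measurable lebesgue"
    using J by (subst measurable_If_restrict_space_iff) auto
  then show ?thesis using assms by (auto simp: controls_def lebesgue_on_UNIV_eq)
qed

lemma controls_restrict: "\<alpha> \<in> controls a A UNIV \<Longrightarrow> \<alpha> \<in> controls a A J"
  by (auto simp: controls_def lebesgue_on_UNIV_eq intro: measurable_restrict_space1)

text \<open>Controls are prescribed on open intervals, whereas trajectories integrate over closed
  ones; this lemma discards the end points.\<close>

lemma trajectory_spike:
  assumes "trajectory G F m J \<alpha> y0 y" and N: "finite N"
    and eq: "\<And>t. t \<in> J - N \<Longrightarrow> \<alpha> t = \<beta> t" and J: "\<And>t. t \<in> J \<Longrightarrow> {0..t} \<subseteq> J"
  shows "trajectory G F m J \<beta> y0 y"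
  unfolding trajectory_def
proof (intro ballI conjI)
  fix t assume t: "t \<in> J"
  have e: "field_b G F m (y s) (\<beta> s) = field_b G F m (y s) (\<alpha> s)" if "s \<in> {0..t} - N" for s
    using that J[OF t] eq[of s] by auto
  have int: "(\<lambda>s. field_b G F m (y s) (\<alpha> s)) absolutely_integrable_on {0..t}"
    and y: "y t \<in> simplex_m m" "y t = y0 + integral {0..t} (\<lambda>s. field_b G F m (y s) (\<alpha> s))"
    using assms(1) t by (auto simp: trajectory_def)
  show "(\<lambda>s. field_b G F m (y s) (\<beta> s)) absolutely_integrable_on {0..t}"
    by (rule absolutely_integrable_spike[OF int negligible_finite[OF N] e])
  show "y t = y0 + integral {0..t} (\<lambda>s. field_b G F m (y s) (\<beta> s))"
  proof -
    have "integral {0..t} (\<lambda>s. field_b G F m (y s) (\<alpha> s)) = integral {0..t} (\<lambda>s. field_b G F m (y s) (\<beta> s))"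
      by (rule integral_spike[OF negligible_finite[OF N] e])
    then show ?thesis using y(2) by (simp only:)
  qed
  show "y t \<in> simplex_m m" by (rule y(1))
qed

section \<open>Identification with the values of the control problem\<close>

context simplex_control
begin

text \<open>Infinite-horizon payoffs only: the same family then serves the discounted and the
  finite-horizon problem.\<close>

definition payoffs :: "real^3 \<Rightarrow> (real \<Rightarrow> real) set" where
  "payoffs y0 = {(\<lambda>t. L (y t)) | \<alpha> y. solution {0..} \<alpha> y \<and> y 0 = y0}"

lemma payoffsI: "solution {0..} \<alpha> y \<Longrightarrow> y 0 = y0 \<Longrightarrow> (\<lambda>t. L (y t)) \<in> payoffs y0"
  unfolding payoffs_def by blast

lemma payoffsE:
  assumes "p \<in> payoffs y0"
  obtains \<alpha> y where "solution {0..} \<alpha> y" "p = (\<lambda>t. L (y t))" "y 0 = y0"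
  using assms unfolding payoffs_def by blast

lemma const_control: "a \<le> A \<Longrightarrow> (\<lambda>_. a) \<in> controls a A UNIV"
  by (simp add: controls_def)

lemma payoff_family_payoffs:
  assumes aA: "a \<le> A"
  obtains K C where "payoff_family S payoffs K C"
proof -
  obtain K where K: "0 < K" "\<And>y. y \<in> S \<Longrightarrow> \<bar>L y\<bar> \<le> K" using payoff_bound by blast
  obtain C where C: "0 < C" "\<And>\<alpha> y z t. solution {0..} \<alpha> y \<Longrightarrow> solution {0..} \<alpha> z \<Longrightarrow> 0 \<le> t \<Longrightarrow>
      integral {0..t} (\<lambda>s. L (y s)) - C \<le> integral {0..t} (\<lambda>s. L (z s))" using payoff_comparison by blast
  have "payoff_family S payoffs K C"
  proof
    have "axis 1 (1 / m $ 1) \<in> S"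
      using m by (auto simp: simplex_m_def axis_def inner_vec_def sum_3 less_imp_le less_imp_neq[THEN not_sym])
    then show "S \<noteq> {}" by blast
  next
    fix y0 assume "y0 \<in> S"
    then show "payoffs y0 \<noteq> {}"
      using solution_exists[OF const_control[OF aA]] payoffsI by (metis empty_iff)
  next
    fix y0 p assume "p \<in> payoffs y0"
    then show "continuous_on {0..} p"
      by (auto simp: payoffs_def intro!: continuous_on_payoff solution_continuous_on)
  next
    fix y0 p and t :: real assume "p \<in> payoffs y0" "0 \<le> t"
    then show "\<bar>p t\<bar> \<le> K" using K(2) by (auto simp: payoffs_def solution_def)
  next
    \<comment> \<open>The competitor from y0' is driven by the very control that produced p.\<close>
    fix y0 y0' p assume "y0' \<in> S" "p \<in> payoffs y0"
    then obtain \<alpha> y where y: "solution {0..} \<alpha> y" "p = (\<lambda>t. L (y t))" by (blast elim: payoffsE)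
    then have "\<alpha> \<in> controls a A UNIV" by (simp add: solution_def)
    then obtain z where z: "solution {0..} \<alpha> z" "z 0 = y0'" using solution_exists \<open>y0' \<in> S\<close> by blast
    then have "(\<lambda>t. L (z t)) \<in> payoffs y0'" by (rule payoffsI)
    then show "\<exists>q\<in>payoffs y0'. \<forall>t\<ge>0. integral {0..t} p - C \<le> integral {0..t} q"
      using C(2)[OF y(1) z(1)] y(2) by blast
  next
    fix y0 p and T :: real assume "p \<in> payoffs y0" and T: "0 \<le> T"
    then obtain \<alpha> y where y: "solution {0..} \<alpha> y" "p = (\<lambda>t. L (y t))" "y 0 = y0" by (blast elim: payoffsE)
    show "\<exists>y'\<in>S. (\<lambda>t. p (T + t)) \<in> payoffs y' \<and>
        (\<forall>q\<in>payoffs y'. (\<lambda>t. if t < T then p t else q (t - T)) \<in> payoffs y0)"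
    proof (intro bexI[of _ "y T"] conjI ballI)
      show "y T \<in> S" using y T by (simp add: solution_def)
      show "(\<lambda>t. p (T + t)) \<in> payoffs (y T)"
        unfolding y(2) by (rule payoffsI[OF solution_shift[OF y(1) T]]) simp
      fix q assume "q \<in> payoffs (y T)"
      then obtain \<beta> z where z: "solution {0..} \<beta> z" "q = (\<lambda>t. L (z t))" "z 0 = y T" by (rule payoffsE)
      have "solution {0..T} \<alpha> y"
        using y(1) by (auto simp: solution_def intro: caratheodory_subset)
      \<comment> \<open>For T = 0 the glued path consists of z alone, whose initial point is y 0;
        hence the case distinction.\<close>
      from payoffsI[OF solution_concat[OF this z(1) T z(3)], of y0]
      have "(\<lambda>t. L (if t < T then y t else z (t - T))) \<in> payoffs y0" using y(3) z(3) T by (cases "T = 0") auto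
      then show "(\<lambda>t. if t < T then p t else q (t - T)) \<in> payoffs y0"
        unfolding y(2) z(2) by (simp only: if_distrib[of L])
    qed
  qed (fact K C)+
  then show ?thesis by (rule that)
qed

lemma discounted_value_eq:
  assumes aA: "a \<le> A"
  shows "discounted_value G F m a A \<epsilon> y0 = (SUP p\<in>payoffs y0. discounted \<epsilon> p)"
proof -
  have "(\<exists>\<alpha>. \<alpha> \<in> controls a A {0<..} \<and> trajectory G F m {0..} \<alpha> y0 y) \<longleftrightarrow> (\<exists>\<alpha>. solution {0..} \<alpha> y \<and> y 0 = y0)" for y
  proof
    assume "\<exists>\<alpha>. \<alpha> \<in> controls a A {0<..} \<and> trajectory G F m {0..} \<alpha> y0 y"
    then obtain \<alpha> where \<alpha>: "\<alpha> \<in> controls a A {0<..}" "trajectory G F m {0..} \<alpha> y0 y" by blast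
    let ?\<beta> = "\<lambda>t. if t \<in> {0<..} then \<alpha> t else a"
    have "?\<beta> \<in> controls a A UNIV" by (rule controls_extend[OF \<alpha>(1) _ aA]) auto
    moreover have "trajectory G F m {0..} ?\<beta> y0 y" by (rule trajectory_spike[OF \<alpha>(2), of "{0}"]) auto
    ultimately show "\<exists>\<alpha>. solution {0..} \<alpha> y \<and> y 0 = y0"
      using trajectory_iff_solution[of ?\<beta> "{0..}"] by auto
  next
    assume "\<exists>\<alpha>. solution {0..} \<alpha> y \<and> y 0 = y0"
    then obtain \<alpha> where \<alpha>: "solution {0..} \<alpha> y" "y 0 = y0" by blast
    then have c: "\<alpha> \<in> controls a A UNIV" by (simp add: solution_def)
    then have "trajectory G F m {0..} \<alpha> y0 y" using \<alpha> trajectory_iff_solution[OF c, of "{0..}"] by auto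
    then show "\<exists>\<alpha>. \<alpha> \<in> controls a A {0<..} \<and> trajectory G F m {0..} \<alpha> y0 y"
      using controls_restrict[OF c] by blast
  qed
  then have "{integral {0..} (\<lambda>t. exp (- \<epsilon> * t) * L (y t)) | \<alpha> y.
      \<alpha> \<in> controls a A {0<..} \<and> trajectory G F m {0..} \<alpha> y0 y} = discounted \<epsilon> ` payoffs y0"
    unfolding payoffs_def discounted_def by (auto simp: image_def) (metis, metis)
  then show ?thesis by (simp add: discounted_value_def)
qed

lemma finite_horizon_value_eq:
  assumes aA: "a \<le> A" and T: "0 < T"
  shows "finite_horizon_value G F m a A T y0 = (SUP p\<in>payoffs y0. integral {0..T} p)"
proof -
  have "{integral {0..T} (\<lambda>s. L (y s)) | \<alpha> y. \<alpha> \<in> controls a A {0<..<T} \<and> trajectory G F m {0..T} \<alpha> y0 y}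
     = (\<lambda>p. integral {0..T} p) ` payoffs y0" (is "?A = ?B")
  proof (intro equalityI subsetI)
    fix x assume "x \<in> ?A"
    then obtain \<alpha> y where x: "x = integral {0..T} (\<lambda>s. L (y s))"
      and \<alpha>: "\<alpha> \<in> controls a A {0<..<T}" "trajectory G F m {0..T} \<alpha> y0 y" by blast
    let ?\<beta> = "\<lambda>t. if t \<in> {0<..<T} then \<alpha> t else a"
    have \<beta>: "?\<beta> \<in> controls a A UNIV" by (rule controls_extend[OF \<alpha>(1) _ aA]) auto
    moreover have "trajectory G F m {0..T} ?\<beta> y0 y" by (rule trajectory_spike[OF \<alpha>(2), of "{0, T}"]) auto
    ultimately have sol: "solution {0..T} ?\<beta> y" and y0: "y 0 = y0"
      using trajectory_iff_solution[OF \<beta>, of "{0..T}"] T by auto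
    have "y T \<in> S" using sol T by (simp add: solution_def)
    \<comment> \<open>After T the trajectory is continued with the constant control a, which leaves
      the integral over [0, T] unchanged.\<close>
    then obtain z where z: "solution {0..} (\<lambda>_. a) z" "z 0 = y T"
      using solution_exists[OF const_control[OF aA]] by blast
    let ?y = "\<lambda>t. if t < T then y t else z (t - T)"
    have "(\<lambda>t. L (?y t)) \<in> payoffs y0"
      by (rule payoffsI[OF solution_concat[OF sol z(1) _ z(2)]]) (use y0 T in auto)
    moreover have "integral {0..T} (\<lambda>t. L (?y t)) = x"
      unfolding x by (rule integral_spike[of "{T}"]) auto
    ultimately show "x \<in> ?B" by force
  next
    fix x assume "x \<in> ?B"
    then obtain \<alpha> y where x: "x = integral {0..T} (\<lambda>s. L (y s))" and y: "solution {0..} \<alpha> y" "y 0 = y0"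
      by (auto simp: payoffs_def)
    then have c: "\<alpha> \<in> controls a A UNIV" by (simp add: solution_def)
    have "solution {0..T} \<alpha> y" using y(1) by (auto simp: solution_def intro: caratheodory_subset)
    then have "trajectory G F m {0..T} \<alpha> y0 y"
      using y(2) trajectory_iff_solution[OF c, of "{0..T}"] T by auto
    then show "x \<in> ?A" using x controls_restrict[OF c] by blast
  qed
  then show ?thesis by (simp add: finite_horizon_value_def)
qed

text \<open>The discounted values are shown to converge to l together with the averages; uniqueness
  of uniform limits then evaluates the description in \<open>lambda_HJ\<close> to l.\<close>

lemma finite_horizon_average:
  assumes aA: "a \<le> A"
  shows "uniform_limit S (\<lambda>T y. finite_horizon_value G F m a A T y / T) (\<lambda>_. lambda_HJ G F m a A) at_top"
proof -
  obtain K C where fam: "payoff_family S payoffs K C" using payoff_family_payoffs[OF aA] .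
  interpret payoff_family S payoffs K C by (rule fam)
  obtain l where disc: "uniform_limit S (\<lambda>\<epsilon> y. \<epsilon> * disc_value \<epsilon> y) (\<lambda>_. l) (at_right 0)"
    and horizon: "uniform_limit S (\<lambda>T y. horizon_value T y / T) (\<lambda>_. l) at_top"
    using values_converge .
  have "lambda_HJ G F m a A = l"
    using disc by (intro lambda_HJ_eqI m) (simp add: discounted_value_eq[OF aA] disc_value_def)
  moreover have "uniform_limit S (\<lambda>T y. finite_horizon_value G F m a A T y / T) (\<lambda>_. l) at_top"
  proof (rule uniform_limit_cong[THEN iffD1, OF _ _ horizon])
    show "\<forall>\<^sub>F T in at_top. \<forall>y\<in>S. horizon_value T y / T = finite_horizon_value G F m a A T y / T"
      using eventually_gt_at_top[of 0]
      by eventually_elim (simp add: finite_horizon_value_eq[OF aA] horizon_value_def)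
  qed simp
  ultimately show ?thesis by simp
qed

end

theorem corollary3p3:
  fixes G F :: "real^3^3" and m :: "real^3" and a A :: real
  assumes "nonneg_off_diagonal G" and "nonneg_off_diagonal F"
    and "\<forall>i. 0 < m $ i" and "m v* F = 0"
    and "0 < a" and "a < A"
    and "reducible_matrix G" and "reducible_matrix F"
    and "\<forall>\<alpha>>0. irreducible_matrix (G + \<alpha> *\<^sub>R F)"
    and "bounded (perron_lambda G F ` {0<..})"
    and "\<exists>\<alpha>'. a < \<alpha>' \<and> \<alpha>' < A \<and> (\<forall>\<alpha>>0. perron_lambda G F \<alpha> \<le> perron_lambda G F \<alpha>')"
    and "\<exists>i. perron_e G F m 0 $ i = 0"
    and "\<exists>i. perron_e_infinity G F m $ i = 0"
    and "\<exists>e'. (\<forall>\<alpha>\<ge>0. (perron_e G F m has_vector_derivative e' \<alpha>) (at \<alpha> within {0..})) \<and>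
           ((\<forall>\<alpha>\<ge>0. 0 < e' \<alpha> \<bullet> rot_m m (F *v perron_e G F m \<alpha>)) \<or>
            (\<forall>\<alpha>\<ge>0. e' \<alpha> \<bullet> rot_m m (F *v perron_e G F m \<alpha>) < 0))"
    and "\<exists>\<delta>>0.
           (\<forall>\<beta>\<in>{A - \<delta><..<A + \<delta>}. \<forall>y. trajectory G F m {0..} (\<lambda>_. \<beta>) (perron_e G F m 0) y \<longrightarrow>
              (\<forall>t>0. y t \<notin> perron_set G F m)) \<and>
           (\<forall>\<beta>\<in>{a - \<delta><..<a + \<delta>}. \<forall>y. trajectory G F m {0..} (\<lambda>_. \<beta>) (perron_e_infinity G F m) y \<longrightarrow>
              (\<forall>t>0. y t \<notin> perron_set G F m))"
  shows "uniform_limit (simplex_m m) (\<lambda>T y. finite_horizon_value G F m a A T y / T)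
           (\<lambda>_. lambda_HJ G F m a A) at_top"
proof -
  \<comment> \<open>The irreducibility required by the locale is the assumption taken at \<alpha> =
    a, which is positive.\<close>
  interpret simplex_control G F m a A
    using assms(1-5,9) by unfold_locales auto
  show ?thesis using finite_horizon_average assms(6) by simp
qed

end
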